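(* Let $N\ge1$, $s\in(0,\frac12)$, $\frac{1}{1-s}<p<2$, let $U\subset\mathbb{R}^N_+$ be an open set, and let $V\in L^\infty_{loc}(U)$. Suppose that $u\in\widetilde{W}^{s,p}(U)\cap\widetilde{W}^{s,p}(\mathcal{T}(U))\cap L^\infty(\mathbb{R}^N)\cap C(\mathbb{R}^N)$ is a weak solution of $$\begin{cases}(-\Delta)_p^s u-(-\Delta)_p^s u^*\ge V(x)(u-u^* ) & \text{in } U,\\ u\ge u^* & \text{in } \mathbb{R}^N_+\setminus U,\end{cases}$$ and that $u\ge u^*$ in $\mathbb{R}^N_+$. Then either $u\equiv u^*$ in $\mathbb{R}^N$, or $u-u^*>0$ in $U$.
   Context: Notation: $\mathbb{R}^N_+=\{x=(x',x_N)\in\mathbb{R}^{N-1}\times\mathbb{R}: x_N>0\}$; $x^*=(x',-x_N)$; $\mathcal{T}(U)=\{x^*:x\in U\}$; $u^*(x)=u(x^* )$; $J_u(x,y)=|u(x)-u(y)|^{p-2}(u(x)-u(y))$. Function spaces: $[u]_{s,p}=\left(\int_{\mathbb{R}^N}\int_{\mathbb{R}^N}\frac{|u(x)-u(y)|^p}{|x-y|^{N+sp}}\,dx\,dy\right)^{1/p}$; $W^{s,p}(\mathbb{R}^N)=\{u\in L^p(\mathbb{R}^N):[u]_{s,p}<\infty\}$ with norm $\|u\|_{L^p(\mathbb{R}^N)}+[u]_{s,p}$; for an open set $\Omega$, $W^{s,p}_0(\Omega)=\{u\in W^{s,p}(\mathbb{R}^N): u=0 \text{ a.e. in } \mathbb{R}^N\setminus\Omega\}$,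 with dual space $W_0^{s,p}(\Omega)'$; $$\widetilde{W}^{s,p}(\Omega)=\left\{u\in L^p_{loc}(\mathbb{R}^N):\int_\Omega\int_{\mathbb{R}^N}\frac{|u(x)-u(y)|^p}{|x-y|^{N+sp}}\,dx\,dy<\infty\right\}.$$ Operator: for $u\in\widetilde{W}^{s,p}(\Omega)$ and $\varphi\in W_0^{s,p}(\Omega)$, $$\langle(-\Delta)_p^su,\varphi\rangle=\int_{\mathbb{R}^N}\int_{\mathbb{R}^N}\frac{J_u(x,y)(\varphi(x)-\varphi(y))}{|x-y|^{N+sp}}\,dx\,dy.$$ Weak solution of the inequality problem: $u\in\widetilde{W}^{s,p}(U)\cap\widetilde{W}^{s,p}(\mathcal{T}(U))$ is a (weak) solution if $u\ge u^*$ in $\mathbb{R}^N_+\setminus U$, $V(u-u^* )\in W_0^{s,p}(U)'$, and $\langle(-\Delta)_p^su,\varphi\rangle-\langle(-\Delta)_p^su^*,\varphi\rangle\ge\int_UV(x)(u-u^* )\varphi\,dx$ for all $\varphi\in W_0^{s,p}(U)$ with $\varphi\ge0$. *)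

theory Defs
  imports "HOL-Analysis.Analysis"
begin

(* R^N is real^'n with N = CARD('n). The index k is the coordinate written last,
   so that x_N is x $ k; no order on 'n is needed. *)

definition halfspace :: "'n::finite \<Rightarrow> (real^'n) set" where
  "halfspace k = {x. x $ k > 0}"

definition reflect :: "'n::finite \<Rightarrow> real^'n \<Rightarrow> real^'n" where
  "reflect k x = (\<chi> i. if i = k then - (x $ i) else x $ i)"

definition star :: "'n::finite \<Rightarrow> (real^'n \<Rightarrow> real) \<Rightarrow> real^'n \<Rightarrow> real" where
  "star k u = (\<lambda>x. u (reflect k x))"

(* Elements of the function spaces are Lebesgue measurable functions, not a.e. classes. *)

definition Lp :: "real \<Rightarrow> (real^'n::finite \<Rightarrow> real) set" where
  "Lp p = {u \<in> borel_measurable lebesgue.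
             (\<integral>\<^sup>+x. ennreal (\<bar>u x\<bar> powr p) \<partial>lebesgue) < \<infinity>}"

definition Lp_norm :: "real \<Rightarrow> (real^'n::finite \<Rightarrow> real) \<Rightarrow> real" where
  "Lp_norm p u = enn2real (\<integral>\<^sup>+x. ennreal (\<bar>u x\<bar> powr p) \<partial>lebesgue) powr (1 / p)"

definition Lp_loc :: "real \<Rightarrow> (real^'n::finite \<Rightarrow> real) set" where
  "Lp_loc p = {u \<in> borel_measurable lebesgue.
     \<forall>K. compact K \<longrightarrow> (\<integral>\<^sup>+x\<in>K. ennreal (\<bar>u x\<bar> powr p) \<partial>lebesgue) < \<infinity>}"

definition Linf :: "(real^'n::finite \<Rightarrow> real) set" where
  "Linf = {u \<in> borel_measurable lebesgue. \<exists>C. AE x in lebesgue. \<bar>u x\<bar> \<le> C}"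

definition Linf_loc :: "(real^'n::finite) set \<Rightarrow> (real^'n \<Rightarrow> real) set" where
  "Linf_loc U = {V \<in> borel_measurable (lebesgue_on U).
     \<forall>K. compact K \<and> K \<subseteq> U \<longrightarrow> (\<exists>C. AE x in lebesgue. x \<in> K \<longrightarrow> \<bar>V x\<bar> \<le> C)}"

(* On the diagonal the denominator is 0 powr _ = 0, so the quotients below are 0 there;
   the diagonal is a null set. *)

definition kernel_denom :: "real \<Rightarrow> real \<Rightarrow> real^'n::finite \<Rightarrow> real^'n \<Rightarrow> real" where
  "kernel_denom s p x y = norm (x - y) powr (real CARD('n) + s * p)"

definition gagliardo :: "real \<Rightarrow> real \<Rightarrow> (real^'n::finite) set \<Rightarrow> (real^'n \<Rightarrow> real) \<Rightarrow> ennreal" where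
  "gagliardo s p \<Omega> u =
     (\<integral>\<^sup>+z \<in> \<Omega> \<times> UNIV. ennreal (\<bar>u (fst z) - u (snd z)\<bar> powr p / kernel_denom s p (fst z) (snd z))
        \<partial>(lebesgue \<Otimes>\<^sub>M lebesgue))"

definition Wsp :: "real \<Rightarrow> real \<Rightarrow> (real^'n::finite \<Rightarrow> real) set" where
  "Wsp s p = {u \<in> Lp p. gagliardo s p UNIV u < \<infinity>}"

definition Wsp_norm :: "real \<Rightarrow> real \<Rightarrow> (real^'n::finite \<Rightarrow> real) \<Rightarrow> real" where
  "Wsp_norm s p u = Lp_norm p u + enn2real (gagliardo s p UNIV u) powr (1 / p)"

definition Wsp0 :: "real \<Rightarrow> real \<Rightarrow> (real^'n::finite) set \<Rightarrow> (real^'n \<Rightarrow> real) set" where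
  "Wsp0 s p \<Omega> = {u \<in> Wsp s p. AE x in lebesgue. x \<notin> \<Omega> \<longrightarrow> u x = 0}"

definition Wsp_tilde :: "real \<Rightarrow> real \<Rightarrow> (real^'n::finite) set \<Rightarrow> (real^'n \<Rightarrow> real) set" where
  "Wsp_tilde s p \<Omega> = {u \<in> Lp_loc p. gagliardo s p \<Omega> u < \<infinity>}"

definition Wsp0_dual :: "real \<Rightarrow> real \<Rightarrow> (real^'n::finite) set \<Rightarrow> ((real^'n \<Rightarrow> real) \<Rightarrow> real) set" where
  "Wsp0_dual s p \<Omega> = {F.
     (\<forall>\<phi>\<in>Wsp0 s p \<Omega>. \<forall>\<psi>\<in>Wsp0 s p \<Omega>. F (\<lambda>x. \<phi> x + \<psi> x) = F \<phi> + F \<psi>) \<and>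
     (\<forall>c. \<forall>\<phi>\<in>Wsp0 s p \<Omega>. F (\<lambda>x. c * \<phi> x) = c * F \<phi>) \<and>
     (\<exists>C. \<forall>\<phi>\<in>Wsp0 s p \<Omega>. \<bar>F \<phi>\<bar> \<le> C * Wsp_norm s p \<phi>)}"

(* A function f belongs to the dual space when it acts on it by integration.
   Integrability is required separately: the Bochner integral of a non-integrable
   function is 0 by convention. *)
definition in_Wsp0_dual :: "real \<Rightarrow> real \<Rightarrow> (real^'n::finite) set \<Rightarrow> (real^'n \<Rightarrow> real) \<Rightarrow> bool" where
  "in_Wsp0_dual s p \<Omega> f \<longleftrightarrow>
     (\<forall>\<phi>\<in>Wsp0 s p \<Omega>. set_integrable lebesgue \<Omega> (\<lambda>x. f x * \<phi> x)) \<and>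
     (\<lambda>\<phi>. LINT x:\<Omega>|lebesgue. f x * \<phi> x) \<in> Wsp0_dual s p \<Omega>"

definition J :: "real \<Rightarrow> (real^'n::finite \<Rightarrow> real) \<Rightarrow> real^'n \<Rightarrow> real^'n \<Rightarrow> real" where
  "J p u x y = \<bar>u x - u y\<bar> powr (p - 2) * (u x - u y)"

(* The pairing of (-Delta)_p^s u with phi. By Hoelder's inequality the integral converges
   absolutely for u in Wsp_tilde s p Omega and phi in Wsp0 s p Omega. *)
definition frac_p_laplacian ::
    "real \<Rightarrow> real \<Rightarrow> (real^'n::finite \<Rightarrow> real) \<Rightarrow> (real^'n \<Rightarrow> real) \<Rightarrow> real" where
  "frac_p_laplacian s p u \<phi> =
     (LINT z|(lebesgue \<Otimes>\<^sub>M lebesgue).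
        J p u (fst z) (snd z) * (\<phi> (fst z) - \<phi> (snd z)) / kernel_denom s p (fst z) (snd z))"

definition weak_solution ::
    "'n::finite \<Rightarrow> real \<Rightarrow> real \<Rightarrow> (real^'n) set \<Rightarrow> (real^'n \<Rightarrow> real) \<Rightarrow> (real^'n \<Rightarrow> real) \<Rightarrow> bool" where
  "weak_solution k s p U V u \<longleftrightarrow>
     u \<in> Wsp_tilde s p U \<inter> Wsp_tilde s p (reflect k ` U) \<and>
     (AE x in lebesgue. x \<in> halfspace k - U \<longrightarrow> u x \<ge> star k u x) \<and>
     in_Wsp0_dual s p U (\<lambda>x. V x * (u x - star k u x)) \<and>
     (\<forall>\<phi>\<in>Wsp0 s p U. (AE x in lebesgue. \<phi> x \<ge> 0) \<longrightarrow>
        frac_p_laplacian s p u \<phi> - frac_p_laplacian s p (star k u) \<phi>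
          \<ge> (LINT x:U|lebesgue. V x * (u x - star k u x) * \<phi> x))"

end

theory Submission
  imports Defs
begin

text \<open>
Write \<open>u\<^sup>* = star k u\<close>, \<open>w = u - u\<^sup>*\<close> and \<open>q = p - 1\<close>. The function \<open>w\<close> is continuous, odd under the
reflection and nonnegative on the half-space. If the conclusion fails, then \<open>w\<close> vanishes at some
\<open>x\<^sub>0\<close> in \<open>U\<close> and exceeds some \<open>\<delta> > 0\<close> on a closed ball \<open>K\<close> of the half-space. The idea is that \<open>K\<close>
pulls the nonlocal operator down near \<open>x\<^sub>0\<close> by a fixed amount, while all the errors made by testing
near \<open>x\<^sub>0\<close> at height \<open>\<epsilon>\<close> are of size \<open>\<epsilon>\<^sup>q\<close>.

Let \<open>f\<close> be a Lipschitz bump of height 1 on a small ball about \<open>x\<^sub>0\<close>, disjoint from \<open>K\<close>, and test with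
\<open>\<phi> = max 0 (\<epsilon> f - \<bar>w\<bar>)\<close>. This function lies in \<open>W\<^sub>0\<close> of \<open>U\<close>, and \<open>0 \<le> w \<le> \<epsilon>\<close> wherever it is
positive. So the potential term is at least \<open>- C \<epsilon> \<integral>\<phi>\<close>.

For the other side, let \<open>F(x,y)\<close> be the integrand of the difference of the two pairings. Reflecting
\<open>x\<close>, \<open>y\<close> or both preserves the integral of \<open>F\<close>, hence \<open>F\<close> may be replaced by a quarter of the sum of
its four reflected copies, and that sum need only be estimated for \<open>x\<close> and \<open>y\<close> in the closed
half-space (\<open>integral_le_by_reflection\<close>). With \<open>a = \<phi> x\<close>, \<open>b = \<phi> y\<close>, \<open>k\<^sub>1\<close> the singular kernel at
\<open>x - y\<close> and \<open>k\<^sub>2 \<le> k\<^sub>1\<close> the one at \<open>x - y\<^sup>*\<close>, the sum equals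
\<open>G\<^sub>1 (a - b) k\<^sub>1 + G\<^sub>2 (a + b) k\<^sub>2\<close>, where \<open>G\<^sub>1\<close> and \<open>G\<^sub>2\<close> are increments of the odd power
\<open>t \<bar>t\<bar>\<^sup>p\<^sup>-\<^sup>2\<close> (\<open>symm_energy_density\<close>).

Two properties of this power decide everything. It is monotone, which makes \<open>G\<^sub>1\<close> uniformly negative
when \<open>y\<close> is in \<open>K\<close> and \<open>x\<close> is near \<open>x\<^sub>0\<close>. And because \<open>p < 2\<close> it is Hoelder continuous with exponent \<open>q\<close>,
so that the singular contributions are at most a constant times \<open>\<epsilon>\<^sup>q \<bar>f x - f y\<bar>\<^sup>q k\<^sub>1 (a + b)\<close>. The
condition \<open>1 / (1 - s) < p\<close> says \<open>s p < q\<close>, which is exactly what makes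
\<open>min(1, \<bar>z\<bar>/r)\<^sup>q \<bar>z\<bar>\<^sup>-\<^sup>N\<^sup>-\<^sup>s\<^sup>p\<close> integrable (\<open>trunc_kernel_finite\<close>).
Integrating the pointwise bound gives
\<open>\<integral>\<integral>F \<le> 2 \<integral>\<phi> (4 M \<epsilon>\<^sup>q - c \<bar>K\<bar>)\<close> with \<open>M\<close>, \<open>c > 0\<close> independent of \<open>\<epsilon>\<close> (\<open>energy_upper\<close>). As \<open>\<integral>\<phi> > 0\<close>,
this contradicts the lower bound \<open>- C \<epsilon> \<integral>\<phi>\<close> once \<open>\<epsilon>\<close> is small.
\<close>

section \<open>The odd power\<close>

text \<open>Normalizing to \<open>x + y = 1\<close>, this is \<open>t \<le> t\<^sup>q\<close> on the unit interval, applied twice.\<close>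

lemma powr_add_le_add_powr:
  fixes x y q :: real
  assumes "0 \<le> x" "0 \<le> y" "0 < q" "q \<le> 1"
  shows "(x + y) powr q \<le> x powr q + y powr q"
proof (cases "x + y = 0")
  case True
  then show ?thesis by simp
next
  case False
  then have s: "x + y > 0" using assms by simp
  have le: "t \<le> t powr q" if "0 \<le> t" "t \<le> 1" for t :: real
  proof (cases "t = 0")
    case False
    then show ?thesis using powr_mono'[of q 1 t] assms that by simp
  qed simp
  have "x / (x+y) + y / (x+y) \<le> (x / (x+y)) powr q + (y / (x+y)) powr q"
    using assms s by (intro add_mono le) auto
  also have "x / (x+y) + y / (x+y) = 1" using s by (simp flip: add_divide_distrib)
  also have "(x / (x+y)) powr q + (y / (x+y)) powr q = (x powr q + y powr q) / (x+y) powr q"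
    using assms by (simp add: powr_divide add_divide_distrib)
  finally show ?thesis using s by (simp add: field_simps)
qed

definition spow :: "real \<Rightarrow> real \<Rightarrow> real" where
  "spow p t = \<bar>t\<bar> powr (p - 2) * t"

lemma J_eq_spow: "J p v x y = spow p (v x - v y)"
  by (simp add: J_def spow_def)

text \<open>Splitting into positive and negative part turns monotonicity, continuity and the Hoelder estimate
into statements about powers of nonnegative numbers, and removes the negative exponent \<open>p - 2\<close>.\<close>

lemma spow_eq:
  assumes "1 < p"
  shows "spow p t = (max t 0) powr (p - 1) - (max (- t) 0) powr (p - 1)"
proof -
  have *: "r powr (p - 2) * r = r powr (p - 1)" if "0 \<le> r" for r :: real
  proof (cases "r = 0")
    case False
    then show ?thesis using that powr_add[of r "p - 2" 1] by simp
  qed simp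
  show ?thesis
    using *[of t] *[of "-t"] assms by (cases "0 \<le> t") (auto simp: spow_def max_def)
qed

lemma spow_mono:
  assumes "1 < p" "a \<le> b"
  shows "spow p a \<le> spow p b"
  unfolding spow_eq[OF assms(1)] using assms by (intro diff_mono powr_mono2) auto

lemma spow_strict_mono:
  assumes "1 < p" "a < b" shows "spow p a < spow p b"
proof -
  have "max a 0 powr (p - 1) < max b 0 powr (p - 1)" if "0 < b"
    using that assms by (intro powr_less_mono2) auto
  moreover have "max (- b) 0 powr (p - 1) < max (- a) 0 powr (p - 1)" if "\<not> 0 < b"
    using that assms by (intro powr_less_mono2) auto
  moreover have "max a 0 powr (p - 1) \<le> max b 0 powr (p - 1)"
    "max (- b) 0 powr (p - 1) \<le> max (- a) 0 powr (p - 1)"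
    using assms by (auto intro!: powr_mono2)
  ultimately show ?thesis unfolding spow_eq[OF assms(1)] by linarith
qed

lemma continuous_on_spow [continuous_intros]:
  assumes "1 < p" "continuous_on A f"
  shows "continuous_on A (\<lambda>x. spow p (f x))"
  unfolding spow_eq[OF assms(1)] using assms
  by (intro continuous_on_diff continuous_on_powr' continuous_on_max continuous_on_minus continuous_on_const) auto

lemma spow_borel [measurable]: "spow p \<in> borel_measurable borel"
  unfolding spow_def[abs_def] by measurable

text \<open>The Hoelder estimate of exponent \<open>p - 1 \<le> 1\<close>: positive and negative part each change by at most
\<open>T\<close>, and powers with exponent below 1 are subadditive. By monotonicity the one-sided bound \<open>t \<le> T\<close>
suffices, which matters because gap differences are controlled from one side only.\<close>

lemma spow_diff_le:
  assumes "1 < p" "p < 2" "t \<le> T" "0 \<le> T"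
  shows "spow p a - spow p (a - t) \<le> 2 * T powr (p - 1)"
proof -
  have *: "max c 0 powr (p-1) \<le> max (c - T) 0 powr (p - 1) + T powr (p - 1)" for c
  proof -
    have "max c 0 powr (p-1) \<le> (max (c - T) 0 + T) powr (p - 1)"
      using assms by (intro powr_mono2) auto
    also have "\<dots> \<le> max (c - T) 0 powr (p - 1) + T powr (p - 1)"
      using assms by (intro powr_add_le_add_powr) auto
    finally show ?thesis .
  qed
  have "spow p a - spow p (a - t) \<le> spow p a - spow p (a - T)"
    using spow_mono[of p "a - T" "a - t"] assms by simp
  also have "\<dots> \<le> 2 * T powr (p - 1)"
    unfolding spow_eq[OF assms(1)] using *[of a] *[of "T - a"] by (simp add: algebra_simps)
  finally show ?thesis .
qed

text \<open>A crude form of Young's inequality; it gives the absolute convergence of the pairing.\<close>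

lemma spow_mult_le:
  assumes "1 < p"
  shows "\<bar>spow p a * b\<bar> \<le> \<bar>a\<bar> powr p + \<bar>b\<bar> powr p"
proof -
  have *: "r powr (p - 1) * r = r powr p" if "0 \<le> r" for r :: real
    using that powr_add[of r "p - 1" 1] by (cases "r = 0") auto
  have "\<bar>spow p a\<bar> = \<bar>a\<bar> powr (p - 1)"
    unfolding spow_eq[OF assms] using assms by (auto simp: max_def)
  then have "\<bar>spow p a * b\<bar> = \<bar>a\<bar> powr (p - 1) * \<bar>b\<bar>" by (simp add: abs_mult)
  also have "\<dots> \<le> (max (\<bar>a\<bar>) (\<bar>b\<bar>)) powr (p - 1) * (max (\<bar>a\<bar>) (\<bar>b\<bar>))"
    using assms by (intro mult_mono powr_mono2) auto
  also have "\<dots> = (max (\<bar>a\<bar>) (\<bar>b\<bar>)) powr p" by (intro *) auto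
  also have "\<dots> \<le> \<bar>a\<bar> powr p + \<bar>b\<bar> powr p" by (auto simp: max_def)
  finally show ?thesis .
qed

section \<open>Reflection across a coordinate hyperplane\<close>

lemma reflect_nth: "reflect k x $ i = (if i = k then - (x $ i) else x $ i)"
  by (simp add: reflect_def)

lemma reflect_reflect [simp]: "reflect k (reflect k x) = x"
  by (simp add: vec_eq_iff reflect_nth)

lemma linear_reflect: "linear (reflect k)"
  by (auto intro!: linearI simp: vec_eq_iff reflect_nth)

lemma norm_reflect [simp]: "norm (reflect k x) = norm x"
  unfolding norm_vec_def L2_set_def by (auto intro!: arg_cong[where f=sqrt] sum.cong simp: reflect_nth)

lemma norm_reflect_diff [simp]: "norm (reflect k x - reflect k y) = norm (x - y)"
  by (metis linear_diff linear_reflect norm_reflect)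

lemma norm_reflect_diff_left: "norm (reflect k x - y) = norm (x - reflect k y)"
  by (metis norm_reflect_diff reflect_reflect)

lemma continuous_on_reflect [continuous_intros]:
  "continuous_on A f \<Longrightarrow> continuous_on A (\<lambda>x. reflect k (f x))"
  by (rule bounded_linear.continuous_on[OF linear_reflect[unfolded linear_conv_bounded_linear]])

lemma reflect_borel [measurable]: "reflect k \<in> borel \<rightarrow>\<^sub>M borel"
  by (intro borel_measurable_continuous_onI continuous_on_reflect continuous_on_id)

lemma distr_reflect: "distr lborel borel (reflect k :: real^'n \<Rightarrow> real^'n::finite) = lborel"
proof -
  define c :: "real^'n \<Rightarrow> real" where "c j = (if j = axis k 1 then -1 else 1)" for j
  have eq: "0 + (\<Sum>j\<in>Basis. (c j * (x \<bullet> j)) *\<^sub>R j) = reflect k x" for x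
  proof -
    have "reflect k x = (\<Sum>j\<in>Basis. (reflect k x \<bullet> j) *\<^sub>R j)"
      by (rule euclidean_representation[symmetric])
    also have "\<dots> = (\<Sum>j\<in>Basis. (c j * (x \<bullet> j)) *\<^sub>R j)"
      by (intro sum.cong) (auto simp: Basis_vec_def inner_axis reflect_nth c_def axis_eq_axis)
    finally show ?thesis by simp
  qed
  have "lborel = density (distr lborel borel (\<lambda>x. 0 + (\<Sum>j\<in>Basis. (c j * (x \<bullet> j)) *\<^sub>R j)))
      (\<lambda>_. ennreal (\<Prod>j\<in>Basis. \<bar>c j\<bar>))"
    by (rule lborel_affine_euclidean) (auto simp: c_def)
  also have "(\<Prod>j\<in>Basis. \<bar>c j\<bar>) = 1" by (intro prod.neutral) (auto simp: c_def)
  finally show ?thesis unfolding eq by (simp add: density_1)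
qed

text \<open>Two points on the same side of the hyperplane are closer to each other than to their mirror
images. The singular kernel is therefore larger at \<open>x - y\<close> than at \<open>x - y\<^sup>*\<close>, and the latter stays
bounded as long as \<open>x\<close> keeps away from the hyperplane.\<close>

lemma norm_reflect_ge:
  assumes "0 \<le> x $ k" "0 \<le> y $ k"
  shows "norm (x - y) \<le> norm (x - reflect k y)"
    and "x $ k \<le> norm (x - reflect k y)"
proof -
  have "\<bar>x $ i - y $ i\<bar> \<le> \<bar>x $ i - reflect k y $ i\<bar>" for i
    using assms by (auto simp: reflect_nth)
  then show "norm (x - y) \<le> norm (x - reflect k y)"
    unfolding norm_vec_def by (intro L2_set_mono) auto
  show "x $ k \<le> norm (x - reflect k y)"
    using component_le_norm_cart[of "x - reflect k y" k] assms by (simp add: reflect_nth)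
qed

lemma norm_reflect_greater:
  assumes "0 < x $ k" "0 < y $ k"
  shows "norm (x - y) < norm (x - reflect k y)"
proof -
  have "(\<Sum>i\<in>UNIV. (x $ i - y $ i)\<^sup>2) < (\<Sum>i\<in>UNIV. (x $ i - reflect k y $ i)\<^sup>2)"
  proof (rule sum_strict_mono_ex1)
    show "\<forall>i\<in>UNIV. (x $ i - y $ i)\<^sup>2 \<le> (x $ i - reflect k y $ i)\<^sup>2"
      using assms by (auto simp: reflect_nth intro!: abs_le_square_iff[THEN iffD1])
    have "(x $ k - y $ k)\<^sup>2 < (x $ k - reflect k y $ k)\<^sup>2"
      using mult_pos_pos[OF assms] by (simp add: reflect_nth power2_eq_square algebra_simps)
    then show "\<exists>i\<in>UNIV. (x $ i - y $ i)\<^sup>2 < (x $ i - reflect k y $ i)\<^sup>2" by blast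
  qed simp
  then show ?thesis by (simp add: norm_vec_def L2_set_def)
qed

section \<open>Integrals over pairs of points\<close>

text \<open>The identity carries the product of the completed measures to the product of the Borel measures.
All integrands below are Borel, so every integral can be moved to the latter, where Fubini's theorem
and the linear changes of variables are at hand.\<close>

lemma distr_prod_completion:
  "distr (lebesgue \<Otimes>\<^sub>M lebesgue) (borel \<Otimes>\<^sub>M borel) (\<lambda>z. z) =
     (lborel \<Otimes>\<^sub>M lborel :: ('a::euclidean_space \<times> 'b::euclidean_space) measure)"
proof -
  have 1: "distr lebesgue borel (\<lambda>x. x) = (lborel :: 'c::euclidean_space measure)"
    by (rule measure_eqI) (auto simp: emeasure_distr measurable_completion)
  have "distr lebesgue borel (\<lambda>x. x) \<Otimes>\<^sub>M distr lebesgue borel (\<lambda>x. x) =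
     distr (lebesgue \<Otimes>\<^sub>M lebesgue) (borel \<Otimes>\<^sub>M borel) (\<lambda>(x::'a, y::'b). (x, y))"
    by (rule pair_measure_distr) (auto simp: 1 measurable_completion lborel.sigma_finite_measure_axioms)
  then show ?thesis by (simp add: 1 id_def)
qed

lemma id_measurable_prod_completion:
  "(\<lambda>z. z) \<in> (lebesgue \<Otimes>\<^sub>M lebesgue) \<rightarrow>\<^sub>M (borel \<Otimes>\<^sub>M borel :: ('a::euclidean_space \<times> 'b::euclidean_space) measure)"
proof -
  have "(\<lambda>z. (fst z, snd z)) \<in> (lebesgue \<Otimes>\<^sub>M lebesgue) \<rightarrow>\<^sub>M (borel \<Otimes>\<^sub>M borel :: ('a \<times> 'b) measure)"
    by (intro measurable_Pair measurable_compose[OF measurable_fst] measurable_compose[OF measurable_snd])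
      (auto simp: measurable_completion)
  then show ?thesis by simp
qed

lemma nn_integral_prod_completion:
  fixes g :: "'a::euclidean_space \<times> 'b::euclidean_space \<Rightarrow> ennreal"
  assumes "g \<in> borel_measurable (borel \<Otimes>\<^sub>M borel)"
  shows "(\<integral>\<^sup>+z. g z \<partial>(lebesgue \<Otimes>\<^sub>M lebesgue)) = (\<integral>\<^sup>+z. g z \<partial>(lborel \<Otimes>\<^sub>M lborel))"
  using nn_integral_distr[OF id_measurable_prod_completion, of g] assms
  by (simp add: distr_prod_completion)

lemma integral_prod_completion:
  fixes g :: "'a::euclidean_space \<times> 'b::euclidean_space \<Rightarrow> real"
  assumes "g \<in> borel_measurable (borel \<Otimes>\<^sub>M borel)"
  shows "(LINT z|(lebesgue \<Otimes>\<^sub>M lebesgue). g z) = (LINT z|(lborel \<Otimes>\<^sub>M lborel). g z)"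
  using integral_distr[OF id_measurable_prod_completion, of g] assms
  by (simp add: distr_prod_completion)

lemma distr_prod_map:
  fixes T S :: "'a::euclidean_space \<Rightarrow> 'a"
  assumes "T \<in> borel \<rightarrow>\<^sub>M borel" "S \<in> borel \<rightarrow>\<^sub>M borel"
    and "distr lborel borel T = lborel" "distr lborel borel S = lborel"
  shows "distr (lborel \<Otimes>\<^sub>M lborel) (borel \<Otimes>\<^sub>M borel) (\<lambda>z. (T (fst z), S (snd z))) = lborel \<Otimes>\<^sub>M lborel"
proof -
  have "distr lborel borel T \<Otimes>\<^sub>M distr lborel borel S =
     distr (lborel \<Otimes>\<^sub>M lborel) (borel \<Otimes>\<^sub>M borel) (\<lambda>(x, y). (T x, S y))"
    by (rule pair_measure_distr) (use assms in \<open>auto simp: lborel.sigma_finite_measure_axioms\<close>)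
  then show ?thesis using assms by (simp add: case_prod_beta')
qed

lemma prod_map_measurable:
  fixes T S :: "'a::euclidean_space \<Rightarrow> 'a"
  assumes [measurable]: "T \<in> borel \<rightarrow>\<^sub>M borel" "S \<in> borel \<rightarrow>\<^sub>M borel"
  shows "(\<lambda>z. (T (fst z), S (snd z))) \<in> (borel \<Otimes>\<^sub>M borel) \<rightarrow>\<^sub>M (borel \<Otimes>\<^sub>M borel)"
    "(\<lambda>z. (T (fst z), S (snd z))) \<in> (lborel \<Otimes>\<^sub>M lborel) \<rightarrow>\<^sub>M (borel \<Otimes>\<^sub>M borel)"
  by measurable

lemma integral_prod_map:
  fixes T S :: "'a::euclidean_space \<Rightarrow> 'a" and F :: "'a \<times> 'a \<Rightarrow> real"
  assumes "T \<in> borel \<rightarrow>\<^sub>M borel" "S \<in> borel \<rightarrow>\<^sub>M borel"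
    and "distr lborel borel T = lborel" "distr lborel borel S = lborel"
    and F: "integrable (lborel \<Otimes>\<^sub>M lborel) F"
  shows "integrable (lborel \<Otimes>\<^sub>M lborel) (\<lambda>z. F (T (fst z), S (snd z)))"
    and "(LINT z|(lborel \<Otimes>\<^sub>M lborel). F (T (fst z), S (snd z))) = (LINT z|(lborel \<Otimes>\<^sub>M lborel). F z)"
proof -
  note d = distr_prod_map[OF assms(1-4)]
  have [measurable]: "F \<in> borel_measurable (borel \<Otimes>\<^sub>M borel)"
    using borel_measurable_integrable[OF F] by simp
  show "integrable (lborel \<Otimes>\<^sub>M lborel) (\<lambda>z. F (T (fst z), S (snd z)))"
    using integrable_distr_eq[OF prod_map_measurable(2)[OF assms(1,2)], of F] F by (simp add: d)
  show "(LINT z|(lborel \<Otimes>\<^sub>M lborel). F (T (fst z), S (snd z))) = (LINT z|(lborel \<Otimes>\<^sub>M lborel). F z)"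
    using integral_distr[OF prod_map_measurable(2)[OF assms(1,2)], of F] by (simp add: d)
qed

section \<open>Symmetrization by reflections\<close>

definition symm :: "'n::finite \<Rightarrow> (real^'n \<Rightarrow> real^'n \<Rightarrow> real) \<Rightarrow> real^'n \<Rightarrow> real^'n \<Rightarrow> real" where
  "symm k F x y = F x y + F (reflect k x) y + F x (reflect k y) + F (reflect k x) (reflect k y)"

lemma symm_reflect [simp]:
  "symm k F (reflect k x) y = symm k F x y" "symm k F x (reflect k y) = symm k F x y"
  by (simp_all add: symm_def)

lemma symm_integral:
  fixes F :: "real^'n::finite \<Rightarrow> real^'n \<Rightarrow> real"
  assumes F: "integrable (lborel \<Otimes>\<^sub>M lborel) (\<lambda>z. F (fst z) (snd z))"
  shows "integrable (lborel \<Otimes>\<^sub>M lborel) (\<lambda>z. symm k F (fst z) (snd z))"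
    and "(LINT z|(lborel \<Otimes>\<^sub>M lborel). symm k F (fst z) (snd z))
       = 4 * (LINT z|(lborel \<Otimes>\<^sub>M lborel). F (fst z) (snd z))"
proof -
  note m = integral_prod_map[where F = "\<lambda>z. F (fst z) (snd z)", OF _ _ _ _ F]
  have i: "distr lborel borel (\<lambda>x. x) = (lborel :: (real^'n) measure)"
    by (rule distr_id2) simp
  note m1 = m[of "reflect k" "\<lambda>x. x", OF reflect_borel _ distr_reflect i]
  note m2 = m[of "\<lambda>x. x" "reflect k", OF _ reflect_borel i distr_reflect]
  note m3 = m[of "reflect k" "reflect k", OF reflect_borel reflect_borel distr_reflect distr_reflect]
  show "integrable (lborel \<Otimes>\<^sub>M lborel) (\<lambda>z. symm k F (fst z) (snd z))"
    unfolding symm_def using m1 m2 m3 F by simp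
  show "(LINT z|(lborel \<Otimes>\<^sub>M lborel). symm k F (fst z) (snd z))
       = 4 * (LINT z|(lborel \<Otimes>\<^sub>M lborel). F (fst z) (snd z))"
    unfolding symm_def using m1 m2 m3 F by simp
qed

text \<open>Symmetrizing multiplies an integral by 4, and a symmetrized function is determined by its values
on the closed half-space. The comparison is allowed to mix \<open>Q x y\<close> with \<open>Q y x\<close>, since exchanging
the variables preserves the integral too; this is where the factor 2 comes from.\<close>

lemma integral_le_by_reflection:
  fixes F Q :: "real^'n::finite \<Rightarrow> real^'n \<Rightarrow> real"
  assumes F: "integrable (lborel \<Otimes>\<^sub>M lborel) (\<lambda>z. F (fst z) (snd z))"
    and Q: "integrable (lborel \<Otimes>\<^sub>M lborel) (\<lambda>z. Q (fst z) (snd z))"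
    and le: "\<And>x y. 0 \<le> x $ k \<Longrightarrow> 0 \<le> y $ k \<Longrightarrow> symm k F x y \<le> symm k Q x y + symm k Q y x"
  shows "(LINT z|(lborel \<Otimes>\<^sub>M lborel). F (fst z) (snd z)) \<le> 2 * (LINT z|(lborel \<Otimes>\<^sub>M lborel). Q (fst z) (snd z))"
proof -
  have le': "symm k F x y \<le> symm k Q x y + symm k Q y x" for x y
  proof -
    \<comment> \<open>Folding onto the closed half-space does not change symmetrized functions.\<close>
    define T where "T x = (if 0 \<le> x $ k then x else reflect k x)" for x :: "real^'n"
    have "0 \<le> T x $ k" for x by (simp add: T_def reflect_nth)
    moreover have "symm k G (T x) (T y) = symm k G x y" for G x y by (simp add: T_def)
    ultimately show ?thesis using le[of "T x" "T y"] by simp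
  qed
  note FI = symm_integral[OF F, of k] and QI = symm_integral[OF Q, of k]
  have [measurable]: "(\<lambda>z. symm k Q (fst z) (snd z)) \<in> borel_measurable (lborel \<Otimes>\<^sub>M lborel)"
    using QI(1) by (rule borel_measurable_integrable)
  have swap: "integrable (lborel \<Otimes>\<^sub>M lborel) (\<lambda>z. symm k Q (snd z) (fst z))"
    "(LINT z|(lborel \<Otimes>\<^sub>M lborel). symm k Q (snd z) (fst z)) = (LINT z|(lborel \<Otimes>\<^sub>M lborel). symm k Q (fst z) (snd z))"
    using lborel_pair.integrable_product_swap[OF QI(1)]
      lborel_pair.integral_product_swap[of "\<lambda>z. symm k Q (fst z) (snd z)"] by (simp_all add: case_prod_beta')
  have "(LINT z|(lborel \<Otimes>\<^sub>M lborel). symm k F (fst z) (snd z))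
     \<le> (LINT z|(lborel \<Otimes>\<^sub>M lborel). symm k Q (fst z) (snd z) + symm k Q (snd z) (fst z))"
    using FI(1) QI(1) swap(1) by (intro integral_mono le') auto
  also have "\<dots> = 2 * (LINT z|(lborel \<Otimes>\<^sub>M lborel). symm k Q (fst z) (snd z))"
    using QI(1) swap by simp
  finally show ?thesis by (simp add: FI QI)
qed

section \<open>Integrability of the truncated singular kernel\<close>

lemma nn_integral_translate_radial:
  fixes g :: "real \<Rightarrow> ennreal" and x :: "'a::euclidean_space"
  assumes [measurable]: "g \<in> borel_measurable borel"
  shows "(\<integral>\<^sup>+y. g (norm (x - y)) \<partial>lborel) = (\<integral>\<^sup>+y. g (norm (y :: 'a)) \<partial>lborel)"
proof -
  have "(\<integral>\<^sup>+y. g (norm (y :: 'a)) \<partial>lborel) = (\<integral>\<^sup>+y. g (norm (y :: 'a)) \<partial>distr lborel borel ((+) (- x) :: 'a \<Rightarrow> 'a))"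
    by (simp add: lborel_distr_plus)
  also have "\<dots> = (\<integral>\<^sup>+y. g (norm (- x + y)) \<partial>lborel)"
    by (subst nn_integral_distr) auto
  also have "\<dots> = (\<integral>\<^sup>+y. g (norm (x - y)) \<partial>lborel)"
    by (simp add: norm_minus_commute)
  finally show ?thesis ..
qed

lemma nn_integral_convolution:
  fixes g :: "real \<Rightarrow> ennreal" and h :: "'a::euclidean_space \<Rightarrow> ennreal"
  assumes [measurable]: "g \<in> borel_measurable borel" "h \<in> borel_measurable borel"
  shows "(\<integral>\<^sup>+z. h (fst z) * g (norm (fst z - snd z)) \<partial>(lborel \<Otimes>\<^sub>M lborel))
     = (\<integral>\<^sup>+x. h x \<partial>lborel) * (\<integral>\<^sup>+y. g (norm (y :: 'a)) \<partial>lborel)"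
proof -
  have "(\<integral>\<^sup>+z. h (fst z) * g (norm (fst z - snd z)) \<partial>(lborel \<Otimes>\<^sub>M lborel))
     = (\<integral>\<^sup>+x. \<integral>\<^sup>+y. h x * g (norm (x - y)) \<partial>lborel \<partial>lborel)"
    by (subst lborel.nn_integral_fst[symmetric]) auto
  also have "\<dots> = (\<integral>\<^sup>+x. h x * (\<integral>\<^sup>+y. g (norm (y :: 'a)) \<partial>lborel) \<partial>lborel)"
    by (intro nn_integral_cong) (simp add: nn_integral_cmult nn_integral_translate_radial)
  also have "\<dots> = (\<integral>\<^sup>+x. h x \<partial>lborel) * (\<integral>\<^sup>+y. g (norm (y :: 'a)) \<partial>lborel)"
    by (rule nn_integral_multc) auto
  finally show ?thesis .
qed

text \<open>On a dyadic shell the integrand is comparable to \<open>R powr (\<gamma> - N)\<close> and the volume to \<open>R\<^sup>N\<close>. The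
constant covers both signs of the exponent at once: the power is at most the sum of its values at \<open>R\<close>
and \<open>2 R\<close>.\<close>

lemma nn_integral_shell_le:
  fixes R \<gamma> :: real
  assumes R: "0 < R"
  shows "(\<integral>\<^sup>+x\<in>{x::'a::euclidean_space. R \<le> norm x \<and> norm x < 2 * R}. ennreal (norm x powr (\<gamma> - DIM('a))) \<partial>lborel)
     \<le> ennreal (2 ^ DIM('a) * (1 + 2 powr (\<gamma> - DIM('a))) * unit_ball_vol (DIM('a)) * R powr \<gamma>)"
proof -
  define n where "n = DIM('a)"
  define c where "c = (1 + 2 powr (\<gamma> - n)) * R powr (\<gamma> - n)"
  have le: "t powr (\<gamma> - n) \<le> c" if "R \<le> t" "t < 2 * R" for t
  proof -
    have c_eq: "c = R powr (\<gamma> - n) + (2 * R) powr (\<gamma> - n)"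
      using R by (simp add: c_def powr_mult algebra_simps)
    show ?thesis
    proof (cases "0 \<le> \<gamma> - n")
      case True
      then have "t powr (\<gamma> - n) \<le> (2 * R) powr (\<gamma> - n)"
        using that R by (intro powr_mono2) auto
      then show ?thesis unfolding c_eq using powr_ge_zero[of R "\<gamma> - n"] by linarith
    next
      case False
      then have "t powr (\<gamma> - n) \<le> R powr (\<gamma> - n)"
        using that R by (intro powr_mono2') auto
      then show ?thesis unfolding c_eq using powr_ge_zero[of "2 * R" "\<gamma> - n"] by linarith
    qed
  qed
  have "(\<integral>\<^sup>+x\<in>{x::'a. R \<le> norm x \<and> norm x < 2 * R}. ennreal (norm x powr (\<gamma> - n)) \<partial>lborel)
      \<le> (\<integral>\<^sup>+x. ennreal c * indicator (ball 0 (2 * R) :: 'a set) x \<partial>lborel)"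
    by (intro nn_integral_mono) (auto simp: indicator_def intro!: ennreal_leI le)
  also have "\<dots> = ennreal c * emeasure lborel (ball 0 (2 * R) :: 'a set)"
    by (rule nn_integral_cmult_indicator) simp
  also have "\<dots> = ennreal (c * (unit_ball_vol n * (2 * R) ^ n))"
    using R by (simp add: emeasure_ball n_def c_def ennreal_mult')
  also have "c * (unit_ball_vol n * (2 * R) ^ n) = 2 ^ n * (1 + 2 powr (\<gamma> - n)) * unit_ball_vol n * R powr \<gamma>"
  proof -
    have "R powr (\<gamma> - n) * R ^ n = R powr \<gamma>"
      using R by (simp flip: powr_realpow powr_add)
    then show ?thesis by (simp add: c_def power_mult_distrib mult_ac)
  qed
  finally show ?thesis by (simp add: n_def)
qed

text \<open>A substitute for polar coordinates: the integral of \<open>\<bar>x\<bar> powr (\<gamma> - N)\<close> over a union of dyadic shells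
is bounded by a geometric series. It is used for \<open>\<gamma> > 0\<close> near the origin and for \<open>\<gamma> < 0\<close> near infinity.\<close>

lemma nn_integral_norm_powr_finite:
  fixes \<gamma> :: real and R :: "nat \<Rightarrow> real" and S :: "'a::euclidean_space set"
  assumes R: "\<And>j. 0 < R j" and sum: "summable (\<lambda>j. R j powr \<gamma>)"
    and cover: "\<And>x. x \<in> S \<Longrightarrow> \<exists>j. R j \<le> norm x \<and> norm x < 2 * R j"
  shows "(\<integral>\<^sup>+x\<in>S. ennreal (norm x powr (\<gamma> - DIM('a))) \<partial>lborel) < \<infinity>"
proof -
  let ?g = "\<lambda>x::'a. ennreal (norm x powr (\<gamma> - DIM('a)))"
  let ?E = "\<lambda>j. {x::'a. R j \<le> norm x \<and> norm x < 2 * R j}"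
  define c where "c = 2 ^ DIM('a) * (1 + 2 powr (\<gamma> - DIM('a))) * unit_ball_vol (DIM('a))"
  have c: "0 \<le> c" by (simp add: c_def)
  have "?g x * indicator S x \<le> (\<Sum>j. ?g x * indicator (?E j) x)" for x
  proof (cases "x \<in> S")
    case True
    then obtain j where "x \<in> ?E j" using cover by auto
    then have "?g x * indicator S x \<le> (\<Sum>i\<in>{j}. ?g x * indicator (?E i) x)"
      using True by simp
    also have "\<dots> \<le> (\<Sum>j. ?g x * indicator (?E j) x)"
      by (rule sum_le_suminf) auto
    finally show ?thesis .
  qed simp
  then have "(\<integral>\<^sup>+x\<in>S. ?g x \<partial>lborel) \<le> (\<integral>\<^sup>+x. (\<Sum>j. ?g x * indicator (?E j) x) \<partial>lborel)"
    by (intro nn_integral_mono)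
  also have "\<dots> = (\<Sum>j. \<integral>\<^sup>+x\<in>?E j. ?g x \<partial>lborel)"
    by (rule nn_integral_suminf) auto
  also have "\<dots> \<le> (\<Sum>j. ennreal (c * R j powr \<gamma>))"
    using nn_integral_shell_le[OF R, where 'a='a and \<gamma>=\<gamma>] by (intro suminf_le) (auto simp: c_def)
  also have "\<dots> = ennreal (\<Sum>j. c * R j powr \<gamma>)"
    using c sum by (intro suminf_ennreal2 summable_mult) auto
  finally show ?thesis by (simp add: le_less_trans)
qed

lemma power_powr:
  assumes "0 < (x::real)" shows "(x ^ j) powr e = (x powr e) ^ j"
proof -
  have "(x ^ j) powr e = (x powr j) powr e" using assms by (simp add: powr_realpow)
  also have "\<dots> = (x powr e) powr j" by (simp add: powr_powr mult.commute)
  also have "\<dots> = (x powr e) ^ j" using assms by (intro powr_realpow) simp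
  finally show ?thesis .
qed

text \<open>The singular kernel \<open>t powr - a\<close> times the \<open>q\<close>-th power of the largest oscillation, over the
distance \<open>t\<close>, of a function with values in the unit interval and Lipschitz constant \<open>1 / r\<close>.\<close>

definition trunc_kernel :: "real \<Rightarrow> real \<Rightarrow> real \<Rightarrow> real \<Rightarrow> real" where
  "trunc_kernel r q a t = (min 1 (t / r)) powr q / t powr a"

lemma trunc_kernel_borel [measurable]: "trunc_kernel r q a \<in> borel_measurable borel"
  unfolding trunc_kernel_def[abs_def] by measurable

lemma trunc_kernel_nonneg: "0 \<le> trunc_kernel r q a t"
  by (simp add: trunc_kernel_def)

text \<open>Near the origin the kernel is a multiple of \<open>t powr (q - a)\<close>, integrable because \<open>a - N < q\<close>; beyond
radius \<open>r\<close> it is \<open>t powr - a\<close>, integrable because \<open>N < a\<close>.\<close>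

lemma trunc_kernel_finite:
  fixes r q a :: real
  assumes r: "0 < r" and a: "DIM('a) < a" "a - DIM('a) < q"
  shows "(\<integral>\<^sup>+x. ennreal (trunc_kernel r q a (norm (x::'a::euclidean_space))) \<partial>lborel) < \<infinity>"
proof -
  let ?n = "real DIM('a)"
  let ?N = "{x::'a. 0 < norm x \<and> norm x < r}" and ?F = "{x::'a. r \<le> norm x}"
  let ?gN = "\<lambda>x::'a. ennreal (norm x powr ((q - (a - ?n)) - ?n))"
  let ?gF = "\<lambda>x::'a. ennreal (norm x powr ((?n - a) - ?n))"
  have N: "(\<integral>\<^sup>+x\<in>?N. ?gN x \<partial>lborel) < \<infinity>"
  proof (rule nn_integral_norm_powr_finite[where R = "\<lambda>j. r / 2 * (1/2) ^ j"])
    have "(\<lambda>j. (r / 2 * (1/2) ^ j) powr (q - (a - ?n))) = (\<lambda>j. (r / 2) powr (q - (a - ?n)) * ((1/2) powr (q - (a - ?n))) ^ j)"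
      using r by (subst powr_mult) (auto simp: power_powr)
    moreover have "(1/2::real) powr (q - (a - ?n)) < 1"
      using powr_less_mono'[of "1/2" 0 "q - (a - ?n)"] a by simp
    ultimately show "summable (\<lambda>j. (r / 2 * (1/2) ^ j) powr (q - (a - ?n)))"
      by (simp add: summable_geometric summable_mult)
    fix x :: 'a assume x: "x \<in> ?N"
    obtain n where n: "(1/2) ^ n < norm x / r"
      using real_arch_pow_inv[of "norm x / r" "1/2"] x r by auto
    define P where "P j \<longleftrightarrow> r / 2 * (1/2) ^ j \<le> norm x" for j
    have "P n" using n r by (simp add: P_def field_simps)
    define j where "j = (LEAST j. P j)"
    have "P j" using \<open>P n\<close> unfolding j_def by (rule LeastI)
    moreover have "norm x < 2 * (r / 2 * (1/2) ^ j)"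
    proof (cases j)
      case 0
      then show ?thesis using x by simp
    next
      case (Suc i)
      then have "\<not> P i" unfolding j_def by (metis j_def lessI not_less_Least)
      then show ?thesis using Suc by (simp add: P_def field_simps)
    qed
    ultimately show "\<exists>j. r / 2 * (1/2) ^ j \<le> norm x \<and> norm x < 2 * (r / 2 * (1/2) ^ j)"
      unfolding P_def by blast
  qed (use r in simp)
  have F: "(\<integral>\<^sup>+x\<in>?F. ?gF x \<partial>lborel) < \<infinity>"
  proof (rule nn_integral_norm_powr_finite[where R = "\<lambda>j. r * 2 ^ j"])
    have "(\<lambda>j. (r * 2 ^ j) powr (?n - a)) = (\<lambda>j. r powr (?n - a) * (2 powr (?n - a)) ^ j)"
      using r by (subst powr_mult) (auto simp: power_powr)
    moreover have "(2::real) powr (?n - a) < 1"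
      using powr_less_mono[of "?n - a" 0 2] a by simp
    ultimately show "summable (\<lambda>j. (r * 2 ^ j) powr (?n - a))"
      by (simp add: summable_geometric summable_mult)
    fix x :: 'a assume x: "x \<in> ?F"
    obtain n where n: "norm x / r < 2 ^ n"
      using real_arch_pow[of 2 "norm x / r"] by auto
    define P where "P j \<longleftrightarrow> norm x < 2 * (r * 2 ^ j)" for j
    have "norm x < r * 2 ^ n" "0 < r * 2 ^ n" using n r by (simp_all add: field_simps)
    then have "P n" by (simp add: P_def)
    define j where "j = (LEAST j. P j)"
    have "P j" using \<open>P n\<close> unfolding j_def by (rule LeastI)
    moreover have "r * 2 ^ j \<le> norm x"
    proof (cases j)
      case 0
      then show ?thesis using x by simp
    next
      case (Suc i)
      then have "\<not> P i" unfolding j_def by (metis j_def lessI not_less_Least)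
      then show ?thesis using Suc by (simp add: P_def field_simps)
    qed
    ultimately show "\<exists>j. r * 2 ^ j \<le> norm x \<and> norm x < 2 * (r * 2 ^ j)"
      unfolding P_def by blast
  qed (use r in simp)
  have "ennreal (trunc_kernel r q a (norm x))
      \<le> ennreal (1 / r powr q) * (?gN x * indicator ?N x) + ?gF x * indicator ?F x" for x :: 'a
  proof -
    consider "x = 0" | "0 < norm x" "norm x < r" | "r \<le> norm x" by force
    then show ?thesis
    proof cases
      case 2
      then have "trunc_kernel r q a (norm x) = 1 / r powr q * norm x powr ((q - (a - ?n)) - ?n)"
        using r by (simp add: trunc_kernel_def min_def powr_divide powr_diff)
      then show ?thesis using 2 r by (simp add: ennreal_mult'[symmetric])
    next
      case 3
      then have "trunc_kernel r q a (norm x) = norm x powr ((?n - a) - ?n)"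
        using r by (simp add: trunc_kernel_def min_def powr_minus_divide)
      then show ?thesis using 3 r by simp
    qed (simp add: trunc_kernel_def)
  qed
  then have "(\<integral>\<^sup>+x. ennreal (trunc_kernel r q a (norm (x::'a))) \<partial>lborel)
     \<le> (\<integral>\<^sup>+x. ennreal (1 / r powr q) * (?gN x * indicator ?N x) + ?gF x * indicator ?F x \<partial>lborel)"
    by (rule nn_integral_mono)
  also have "\<dots> = ennreal (1 / r powr q) * (\<integral>\<^sup>+x\<in>?N. ?gN x \<partial>lborel) + (\<integral>\<^sup>+x\<in>?F. ?gF x \<partial>lborel)"
    by (subst nn_integral_add, measurable) (simp add: nn_integral_cmult)
  also have "\<dots> < \<infinity>" using N F by (simp add: ennreal_mult_eq_top_iff less_top[symmetric])
  finally show ?thesis .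
qed

section \<open>Pointwise estimate of a reflected pair\<close>

text \<open>The algebraic core, for one pair of points. The letters stand for \<open>A = u x - u y\<close>, \<open>X = w x\<close>,
\<open>Y = w y\<close>, \<open>a\<close> and \<open>b\<close> for the values of the test function, \<open>d\<close> for the oscillation of the bump, \<open>k1\<close>
and \<open>k2\<close> for the kernel at \<open>x - y\<close> and at \<open>x - y\<^sup>*\<close>, \<open>m1\<close> and \<open>m2\<close> for the integrable envelope at these
two vectors; \<open>j\<close> below is \<open>spow p\<close>.

When \<open>b > 0\<close>, both \<open>X\<close> and \<open>Y\<close> are at most \<open>\<epsilon>\<close> and the two terms are small separately. When \<open>b = 0\<close>,
\<open>Y\<close> is arbitrary and the term with \<open>k2\<close> alone may be large. It is compensated by the same amount of
\<open>k1\<close>: the two increments together equal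
\<open>[j(A) - j(A - X)] + [j(A + Y) - j(A + Y - X)]\<close>, in which the large shift \<open>Y\<close> has cancelled. This is the
second inequality, which keeps the remaining factor \<open>k1 - k2\<close> in order to exploit a strictly negative
increment.\<close>

lemma reflected_pair_bound:
  fixes p \<epsilon> A X Y a b d k1 k2 m1 m2 :: real
  assumes p: "1 < p" "p < 2" and \<epsilon>: "0 < \<epsilon>"
    and X: "0 \<le> X" "X \<le> \<epsilon>" and Y: "0 \<le> Y" "0 < b \<longrightarrow> Y \<le> \<epsilon>"
    and ab: "0 \<le> b" "b \<le> a" and d: "0 \<le> d" "X - Y \<le> \<epsilon> * d"
    and k: "0 \<le> k1" "0 \<le> k2" "b < a \<longrightarrow> k2 \<le> k1"
    and m: "d powr (p - 1) * k1 \<le> m1" "k2 \<le> m2"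
  shows "(spow p A - spow p (A - X + Y)) * (a - b) * k1 + (spow p (A + Y) - spow p (A - X)) * (a + b) * k2
      \<le> 4 * \<epsilon> powr (p - 1) * (a + b) * (m1 + m2)" (is ?thesis1)
    and "b = 0 \<Longrightarrow> 0 < a \<Longrightarrow> (spow p A - spow p (A - X + Y)) * (a - b) * k1 + (spow p (A + Y) - spow p (A - X)) * (a + b) * k2
      \<le> a * ((spow p A - spow p (A - X + Y)) * (k1 - k2) + 4 * \<epsilon> powr (p - 1) * m2)"
      (is "_ \<Longrightarrow> _ \<Longrightarrow> ?S \<le> ?R")
proof -
  let ?e = "\<epsilon> powr (p - 1)"
  let ?g = "spow p A - spow p (A - X + Y)"
  have g: "?g \<le> 2 * ?e * d powr (p - 1)"
  proof -
    have "?g = spow p A - spow p (A - (X - Y))" by (simp add: algebra_simps)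
    also have "\<dots> \<le> 2 * (\<epsilon> * d) powr (p - 1)"
      using p d \<epsilon> by (intro spow_diff_le) auto
    also have "\<dots> = 2 * ?e * d powr (p - 1)"
      using d \<epsilon> by (simp add: powr_mult)
    finally show ?thesis .
  qed
  have m1: "0 \<le> m1" using k(1) m(1) by (smt (verit) mult_nonneg_nonneg powr_ge_zero)
  have m2: "0 \<le> m2" using k m by simp
  have gk: "?g * k' \<le> 2 * ?e * m1" if "0 \<le> k'" "k' \<le> k1" for k'
  proof -
    have "?g * k' \<le> 2 * ?e * d powr (p - 1) * k'"
      using g that by (intro mult_right_mono) auto
    also have "\<dots> \<le> 2 * ?e * d powr (p - 1) * k1"
      using that by (intro mult_left_mono) auto
    also have "\<dots> \<le> 2 * ?e * m1" using m(1) by (simp add: mult.assoc mult_left_mono)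
    finally show ?thesis .
  qed
  have zero: "?S \<le> ?R" if b: "b = 0" and a: "0 < a"
  proof -
    \<comment> \<open>The two brackets left after the shift \<open>Y\<close> has cancelled.\<close>
    have "spow p A - spow p (A - X) \<le> 2 * ?e" "spow p (A + Y) - spow p (A + Y - X) \<le> 2 * ?e"
      using p X \<epsilon> by (auto intro!: spow_diff_le)
    then have "(?g + (spow p (A + Y) - spow p (A - X))) * k2 \<le> (4 * ?e) * m2"
      using k m by (intro mult_mono) (auto simp: algebra_simps)
    then have "a * (?g * (k1 - k2) + (?g + (spow p (A + Y) - spow p (A - X))) * k2) \<le> ?R"
      using a by (intro mult_left_mono) auto
    then show ?thesis using b by (simp add: algebra_simps)
  qed
  show ?thesis1
  proof (cases "b = 0")
    case True
    show ?thesis1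
    proof (cases "a = 0")
      case False
      then have a: "0 < a" using ab by simp
      then have k21: "k2 \<le> k1" using k True by simp
      have "?g * (k1 - k2) \<le> 2 * ?e * m1" using k k21 by (intro gk) auto
      also have "\<dots> \<le> 4 * ?e * m1" using m1 by (intro mult_right_mono) auto
      finally have "?R \<le> a * (4 * ?e * m1 + 4 * ?e * m2)"
        using a by (intro mult_left_mono) auto
      then show ?thesis using zero[OF True a] True by (simp add: algebra_simps)
    qed (use True in simp)
  next
    case False
    then have b: "0 < b" using ab by simp
    have "?g * k1 * (a - b) \<le> 2 * ?e * m1 * (a - b)"
      using ab gk[of k1] k by (intro mult_right_mono) auto
    also have "\<dots> \<le> 4 * ?e * m1 * (a + b)"
      using ab m1 by (intro mult_mono) auto
    finally have 1: "?g * k1 * (a - b) \<le> 4 * ?e * m1 * (a + b)" .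
    have "(X + Y) powr (p - 1) \<le> X powr (p - 1) + Y powr (p - 1)"
      using X Y p by (intro powr_add_le_add_powr) auto
    also have "\<dots> \<le> ?e + ?e"
      using X Y b p by (intro add_mono powr_mono2) auto
    finally have XY: "(X + Y) powr (p - 1) \<le> 2 * ?e" by simp
    have "spow p (A + Y) - spow p (A - X) = spow p (A + Y) - spow p (A + Y - (X + Y))" by simp
    also have "\<dots> \<le> 2 * (X + Y) powr (p - 1)"
      using p X Y by (intro spow_diff_le) auto
    also have "\<dots> \<le> 4 * ?e" using XY by simp
    finally have "(spow p (A + Y) - spow p (A - X)) * k2 \<le> (4 * ?e) * m2"
      using k m by (intro mult_mono) auto
    then have "(spow p (A + Y) - spow p (A - X)) * k2 * (a + b) \<le> 4 * ?e * m2 * (a + b)"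
      using ab by (intro mult_right_mono) auto
    with 1 show ?thesis by (simp add: algebra_simps)
  qed
  show "b = 0 \<Longrightarrow> 0 < a \<Longrightarrow> ?S \<le> ?R" by (rule zero)
qed

lemma kernel_denom_sym: "kernel_denom s p x y = kernel_denom s p y x"
  by (simp add: kernel_denom_def norm_minus_commute)

lemma kernel_denom_nonneg: "0 \<le> kernel_denom s p x y"
  by (simp add: kernel_denom_def)

section \<open>The test function\<close>

text \<open>The setting of the comparison argument near an interior point \<open>x0\<close>. The bound \<open>2 * r \<le> x0 $ k\<close> keeps
the ball of radius \<open>r\<close> about \<open>x0\<close> at distance at least \<open>r\<close> from the hyperplane.\<close>

locale reflected_order =
  fixes k :: "'n::finite" and s p r :: real and x0 :: "real^'n" and u :: "real^'n \<Rightarrow> real"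
  assumes p: "1 < p" "p < 2" and sp: "0 < s * p" "s * p < p - 1"
    and cont: "continuous_on UNIV u"
    and order: "\<And>x. 0 \<le> x $ k \<Longrightarrow> u (reflect k x) \<le> u x"
    and r: "0 < r" "2 * r \<le> x0 $ k"
begin

definition gap :: "real^'n \<Rightarrow> real" where "gap x = u x - u (reflect k x)"

definition bump :: "real^'n \<Rightarrow> real" where "bump x = max 0 (1 - norm (x - x0) / r)"

text \<open>With \<open>\<bar>gap\<bar>\<close> in place of \<open>gap\<close> the function vanishes wherever \<open>bump\<close> does, also in the reflected
half-space, and still inherits its fractional regularity from \<open>bump\<close> and \<open>u\<close>.\<close>

definition bump_test :: "real \<Rightarrow> real^'n \<Rightarrow> real" where "bump_test \<epsilon> x = max 0 (\<epsilon> * bump x - \<bar>gap x\<bar>)"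

definition envelope :: "real \<Rightarrow> real" where "envelope = trunc_kernel r (p - 1) (real CARD('n) + s * p)"

definition energy_density :: "real \<Rightarrow> real^'n \<Rightarrow> real^'n \<Rightarrow> real" where
  "energy_density \<epsilon> x y = (J p u x y - J p (star k u) x y) * (bump_test \<epsilon> x - bump_test \<epsilon> y) / kernel_denom s p x y"

text \<open>An error of order \<open>\<epsilon> powr (p - 1)\<close> with an integrable profile, minus the gain from the set \<open>K\<close>. After
symmetrization, this together with its copy with \<open>x\<close> and \<open>y\<close> exchanged dominates \<open>energy_density\<close>.\<close>

definition majorant :: "real \<Rightarrow> real \<Rightarrow> (real^'n) set \<Rightarrow> real^'n \<Rightarrow> real^'n \<Rightarrow> real" where
  "majorant \<epsilon> c K x y = bump_test \<epsilon> x * (4 * \<epsilon> powr (p - 1) * envelope (norm (x - y)) - c * indicator K y)"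

lemma gap_nonneg: "0 \<le> x $ k \<Longrightarrow> 0 \<le> gap x" using order by (simp add: gap_def)

lemma cont_u: "continuous_on A (\<lambda>x. u (g x))" if "continuous_on A g"
  using continuous_on_compose2[OF cont that] by simp
lemma cont_gap: "continuous_on A gap"
  unfolding gap_def by (intro continuous_intros cont_u)
lemma cont_bump: "continuous_on A bump"
  unfolding bump_def[abs_def] using r by (intro continuous_intros) auto
lemma cont_bump_test: "continuous_on A (bump_test \<epsilon>)"
  unfolding bump_test_def[abs_def] by (intro continuous_intros cont_bump cont_gap)

lemma bump_range: "0 \<le> bump x" "bump x \<le> 1" using r by (auto simp: bump_def)
lemma bump_outside: "x \<notin> ball x0 r \<Longrightarrow> bump x = 0"
  using r by (auto simp: bump_def dist_norm norm_minus_commute field_simps)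
lemma bump_diff: "\<bar>bump x - bump y\<bar> \<le> min 1 (norm (x - y) / r)"
proof -
  have "\<bar>bump x - bump y\<bar> \<le> \<bar>norm (x - x0) / r - norm (y - x0) / r\<bar>"
    by (auto simp: bump_def)
  also have "\<dots> = \<bar>norm (x - x0) - norm (y - x0)\<bar> / r"
    using r by (simp flip: diff_divide_distrib)
  also have "\<dots> \<le> norm (x - y) / r"
    using r norm_triangle_ineq3[of "x - x0" "y - x0"] by (intro divide_right_mono) auto
  finally show ?thesis using bump_range[of x] bump_range[of y] by auto
qed

lemma bump_test_nonneg: "0 \<le> bump_test \<epsilon> x" by (simp add: bump_test_def)
lemma bump_test_outside: "x \<notin> ball x0 r \<Longrightarrow> bump_test \<epsilon> x = 0"
  by (simp add: bump_test_def bump_outside)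
lemma bump_test_le:
  assumes "0 < \<epsilon>" shows "bump_test \<epsilon> x \<le> \<epsilon>"
proof -
  have "\<epsilon> * bump x \<le> \<epsilon>" using bump_range[of x] assms by (simp add: mult_left_le)
  then have "\<epsilon> * bump x - \<bar>gap x\<bar> \<le> \<epsilon>" by linarith
  then show ?thesis using assms by (simp add: bump_test_def)
qed

lemma ball_component: "x \<in> ball x0 r \<Longrightarrow> r < x $ k"
  using component_le_norm_cart[of "x0 - x" k] r by (auto simp: dist_norm)

lemma bump_test_reflect: "0 \<le> x $ k \<Longrightarrow> bump_test \<epsilon> (reflect k x) = 0"
  using ball_component[of "reflect k x"] r by (intro bump_test_outside) (auto simp: reflect_nth)

section \<open>The symmetrized energy density\<close>

text \<open>The copy with both points reflected vanishes, because the test function lives in the half-space.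
The two mixed copies share the kernel at \<open>x - y\<^sup>*\<close> and, by oddness, the same increment.\<close>

lemma symm_energy_density:
  assumes "0 \<le> x $ k" "0 \<le> y $ k"
  shows "symm k (energy_density \<epsilon>) x y =
    (spow p (u x - u y) - spow p (u x - u y - gap x + gap y)) * (bump_test \<epsilon> x - bump_test \<epsilon> y) * (1 / kernel_denom s p x y)
    + (spow p (u x - u y + gap y) - spow p (u x - u y - gap x)) * (bump_test \<epsilon> x + bump_test \<epsilon> y) * (1 / kernel_denom s p x (reflect k y))"
proof -
  have kd: "kernel_denom s p (reflect k x) y = kernel_denom s p x (reflect k y)"
    by (simp add: kernel_denom_def norm_reflect_diff_left)
  have odd: "spow p (- t) = - spow p t" for t by (simp add: spow_def)
  have 1: "spow p (u (reflect k x) - u y) = spow p (u x - u y - gap x)"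
     "spow p (u x - u (reflect k y)) = spow p (u x - u y + gap y)"
     "spow p (u (reflect k x) - u (reflect k y)) = spow p (u x - u y - gap x + gap y)"
    by (auto simp: gap_def algebra_simps)
  show ?thesis
    unfolding symm_def energy_density_def J_eq_spow star_def bump_test_reflect[OF assms(1)] bump_test_reflect[OF assms(2)]
      kd reflect_reflect 1
    by (simp add: algebra_simps add_divide_distrib diff_divide_distrib)
qed

lemma energy_density_sym: "energy_density \<epsilon> x y = energy_density \<epsilon> y x"
proof -
  have "spow p (v y - v x) = - spow p (v x - v y)" for v :: "real^'n \<Rightarrow> real"
    by (simp add: spow_def abs_minus_commute algebra_simps)
  from this[of u] this[of "star k u"] show ?thesis
    unfolding energy_density_def J_eq_spow kernel_denom_sym[of s p y x]
    by (simp add: algebra_simps)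
qed

lemma symm_majorant:
  assumes "0 \<le> x $ k" "0 \<le> y $ k" "K \<subseteq> halfspace k"
  shows "symm k (majorant \<epsilon> c K) x y = bump_test \<epsilon> x * (4 * \<epsilon> powr (p - 1) *
     (envelope (norm (x - y)) + envelope (norm (x - reflect k y))) - c * indicator K y)"
proof -
  have "reflect k y \<notin> K" using assms by (auto simp: halfspace_def reflect_nth)
  then show ?thesis using assms
    unfolding symm_def majorant_def bump_test_reflect[OF assms(1)] by (simp add: algebra_simps)
qed

text \<open>The reflected-pair bound, applied with the actual functions. By symmetry the larger of the two test
values may be taken at \<open>x\<close>, so that \<open>x\<close> lies in the small ball when anything is to be shown. If \<open>y\<close> is in
\<open>K\<close>, the gap grows by at least \<open>\<delta> - \<epsilon> \<ge> \<delta> / 2\<close> from \<open>x\<close> to \<open>y\<close>, and the second form of that bound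
yields the gain \<open>c\<close>.\<close>

lemma pointwise_half:
  assumes x: "0 \<le> x $ k" and y: "0 \<le> y $ k" and \<epsilon>: "0 < \<epsilon>" "2 * \<epsilon> \<le> \<delta>"
    and K: "K \<subseteq> halfspace k" "K \<inter> ball x0 r = {}" "\<And>y. y \<in> K \<Longrightarrow> \<delta> \<le> gap y"
    and c: "\<And>x y. x \<in> ball x0 r \<Longrightarrow> y \<in> K \<Longrightarrow>
      c \<le> (spow p (u x - u y + \<delta> / 2) - spow p (u x - u y)) * (1 / kernel_denom s p x y - 1 / kernel_denom s p x (reflect k y))"
    and ab: "bump_test \<epsilon> y \<le> bump_test \<epsilon> x"
  shows "symm k (energy_density \<epsilon>) x y \<le> symm k (majorant \<epsilon> c K) x y + symm k (majorant \<epsilon> c K) y x"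
proof (cases "bump_test \<epsilon> x = 0")
  case True
  then have "bump_test \<epsilon> y = 0" using ab bump_test_nonneg[of \<epsilon> y] by simp
  with True show ?thesis using x y K by (simp add: symm_energy_density symm_majorant)
next
  case False
  define a where "a = bump_test \<epsilon> x"
  define b where "b = bump_test \<epsilon> y"
  define d where "d = \<bar>bump x - bump y\<bar>"
  define A where "A = u x - u y"
  define k1 where "k1 = 1 / kernel_denom s p x y"
  define k2 where "k2 = 1 / kernel_denom s p x (reflect k y)"
  define m1 where "m1 = envelope (norm (x - y))"
  define m2 where "m2 = envelope (norm (x - reflect k y))"
  let ?e = "\<epsilon> powr (p - 1)"
  have a: "0 < a" using False bump_test_nonneg[of \<epsilon> x] by (simp add: a_def)
  have xb: "x \<in> ball x0 r" using False bump_test_outside by blast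
  have X0: "0 \<le> gap x" and Y0: "0 \<le> gap y" using gap_nonneg x y by auto
  have aw: "a = \<epsilon> * bump x - gap x" using a X0 by (auto simp: a_def bump_test_def)
  have bw: "b = \<epsilon> * bump y - gap y" if "0 < b" using that Y0 by (auto simp: b_def bump_test_def)
  have bw': "\<epsilon> * bump y - gap y \<le> b" using Y0 by (simp add: b_def bump_test_def)
  have b: "0 \<le> b" "b \<le> a" using ab bump_test_nonneg by (auto simp: a_def b_def)
  have \<epsilon>b: "\<epsilon> * bump z \<le> \<epsilon>" for z using bump_range[of z] \<epsilon> by (simp add: mult_left_le)
  have X1: "gap x \<le> \<epsilon>" using \<epsilon>b[of x] aw a by simp
  have Y1: "0 < b \<longrightarrow> gap y \<le> \<epsilon>" using \<epsilon>b[of y] bw by auto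
  have d: "0 \<le> d" "gap x - gap y \<le> \<epsilon> * d"
  proof -
    have "gap x - gap y \<le> \<epsilon> * (bump x - bump y)"
      using aw bw' b by (simp add: algebra_simps)
    also have "\<dots> \<le> \<epsilon> * d" using \<epsilon> by (simp add: d_def)
    finally show "gap x - gap y \<le> \<epsilon> * d" .
  qed (simp add: d_def)
  have k: "0 \<le> k1" "0 \<le> k2" by (simp_all add: k1_def k2_def kernel_denom_nonneg)
  \<comment> \<open>On the diagonal \<open>k1\<close> is 0 by convention and the order fails; but there \<open>a = b\<close>.\<close>
  have k21: "k2 \<le> k1" if "x \<noteq> y"
    unfolding k1_def k2_def kernel_denom_def using norm_reflect_ge[OF x y] that sp
    by (intro divide_left_mono powr_mono2 mult_pos_pos) auto
  have m1: "d powr (p - 1) * k1 \<le> m1"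
    unfolding m1_def envelope_def trunc_kernel_def k1_def kernel_denom_def d_def
    using bump_diff[of x y] p by (auto intro!: divide_right_mono powr_mono2)
  have m2: "k2 \<le> m2"
  proof -
    \<comment> \<open>The truncation in the envelope is inactive at mirror distances.\<close>
    have "r \<le> norm (x - reflect k y)"
      using norm_reflect_ge(2)[OF x y] ball_component[OF xb] by simp
    then have "min 1 (norm (x - reflect k y) / r) = 1" using r by (simp add: min_def)
    then show ?thesis by (simp add: k2_def m2_def envelope_def trunc_kernel_def kernel_denom_def)
  qed
  have "b < a \<longrightarrow> k2 \<le> k1" using k21 by (auto simp: a_def b_def)
  note bounds = reflected_pair_bound[OF p \<epsilon>(1) X0 X1 Y0 Y1 b d k this m1 m2, of A]
  have symmF: "symm k (energy_density \<epsilon>) x y = (spow p A - spow p (A - gap x + gap y)) * (a - b) * k1 + (spow p (A + gap y) - spow p (A - gap x)) * (a + b) * k2"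
    using x y by (simp add: symm_energy_density A_def a_def b_def k1_def k2_def)
  have xK: "x \<notin> K" using K xb by auto
  have symmQ: "symm k (majorant \<epsilon> c K) x y + symm k (majorant \<epsilon> c K) y x = 4 * ?e * (a + b) * (m1 + m2) - c * a * indicator K y"
  proof -
    have "norm (y - x) = norm (x - y)" "norm (y - reflect k x) = norm (x - reflect k y)"
      by (metis norm_minus_commute, metis norm_minus_commute norm_reflect_diff_left)
    then show ?thesis using x y xK K(1)
      by (simp add: symm_majorant a_def b_def m1_def m2_def algebra_simps)
  qed
  show ?thesis
  proof (cases "y \<in> K")
    case False
    then show ?thesis using bounds(1) unfolding symmF symmQ by simp
  next
    case True
    then have "y \<notin> ball x0 r" using K(2) by blast
    then have b0: "b = 0" by (simp add: b_def bump_test_outside)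
    have "x \<noteq> y" using True xK by auto
    then have "0 \<le> k1 - k2" using k21 by simp
    moreover have "spow p (A + \<delta> / 2) \<le> spow p (A - gap x + gap y)"
      using K(3)[OF True] X1 \<epsilon> p by (intro spow_mono) auto
    ultimately have "(spow p A - spow p (A - gap x + gap y)) * (k1 - k2) \<le> (spow p A - spow p (A + \<delta> / 2)) * (k1 - k2)"
      by (intro mult_right_mono) auto
    also have "\<dots> \<le> - c" using c[OF xb True] by (simp add: A_def k1_def k2_def algebra_simps)
    finally have "a * ((spow p A - spow p (A - gap x + gap y)) * (k1 - k2) + 4 * ?e * m2) \<le> a * (- c + 4 * ?e * m2)"
      using a by (intro mult_left_mono) auto
    also have "\<dots> \<le> a * (- c + 4 * ?e * (m1 + m2))"
      using a by (intro mult_left_mono add_mono) (auto simp: m1_def envelope_def trunc_kernel_nonneg)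
    finally show ?thesis using bounds(2)[OF b0 a] True b0 unfolding symmF symmQ by (simp add: algebra_simps)
  qed
qed

lemma pointwise:
  assumes x: "0 \<le> x $ k" and y: "0 \<le> y $ k" and \<epsilon>: "0 < \<epsilon>" "2 * \<epsilon> \<le> \<delta>"
    and K: "K \<subseteq> halfspace k" "K \<inter> ball x0 r = {}" "\<And>y. y \<in> K \<Longrightarrow> \<delta> \<le> gap y"
    and c: "\<And>x y. x \<in> ball x0 r \<Longrightarrow> y \<in> K \<Longrightarrow>
      c \<le> (spow p (u x - u y + \<delta> / 2) - spow p (u x - u y)) * (1 / kernel_denom s p x y - 1 / kernel_denom s p x (reflect k y))"
  shows "symm k (energy_density \<epsilon>) x y \<le> symm k (majorant \<epsilon> c K) x y + symm k (majorant \<epsilon> c K) y x"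
proof (cases "bump_test \<epsilon> y \<le> bump_test \<epsilon> x")
  case True
  show ?thesis by (rule pointwise_half[OF x y \<epsilon> K c True])
next
  case False
  then have "symm k (energy_density \<epsilon>) y x \<le> symm k (majorant \<epsilon> c K) y x + symm k (majorant \<epsilon> c K) x y"
    by (intro pointwise_half[OF y x \<epsilon> K c]) auto
  moreover have "symm k (energy_density \<epsilon>) y x = symm k (energy_density \<epsilon>) x y"
    unfolding symm_def energy_density_sym[of \<epsilon> y x] energy_density_sym[of \<epsilon> "reflect k y" x] energy_density_sym[of \<epsilon> y "reflect k x"]
      energy_density_sym[of \<epsilon> "reflect k y" "reflect k x"] by simp
  ultimately show ?thesis by simp
qed

end

section \<open>Convergence of the pairing and admissibility of the test function\<close>

lemma kernel_denom_borel [measurable]: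
  "(\<lambda>z. kernel_denom s p (fst z) (snd z)) \<in> borel_measurable (borel \<Otimes>\<^sub>M borel)"
  unfolding kernel_denom_def by measurable

lemma quotient_borel [measurable]:
  assumes [measurable]: "v \<in> borel_measurable borel"
  shows "(\<lambda>z. ennreal (\<bar>v (fst z) - v (snd z)\<bar> powr p / kernel_denom s p (fst z) (snd z)))
     \<in> borel_measurable (borel \<Otimes>\<^sub>M borel)"
  by measurable

lemma Times_UNIV_borel [measurable]:
  "U \<in> sets borel \<Longrightarrow> U \<times> UNIV \<in> sets (borel \<Otimes>\<^sub>M borel)"
  by (rule pair_measureI) auto

lemma gagliardo_lborel:
  assumes [measurable]: "v \<in> borel_measurable borel" "U \<in> sets borel"
  shows "gagliardo s p U v = (\<integral>\<^sup>+z. ennreal (\<bar>v (fst z) - v (snd z)\<bar> powr p / kernel_denom s p (fst z) (snd z))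
      * indicator U (fst z) \<partial>(lborel \<Otimes>\<^sub>M lborel))"
proof -
  have "gagliardo s p U v = (\<integral>\<^sup>+z. ennreal (\<bar>v (fst z) - v (snd z)\<bar> powr p / kernel_denom s p (fst z) (snd z))
      * indicator U (fst z) \<partial>(lebesgue \<Otimes>\<^sub>M lebesgue))"
    unfolding gagliardo_def by (intro nn_integral_cong) (auto simp: indicator_def split: prod.splits)
  also have "\<dots> = (\<integral>\<^sup>+z. ennreal (\<bar>v (fst z) - v (snd z)\<bar> powr p / kernel_denom s p (fst z) (snd z))
      * indicator U (fst z) \<partial>(lborel \<Otimes>\<^sub>M lborel))"
    by (rule nn_integral_prod_completion) measurable
  finally show ?thesis .
qed

lemma nn_integral_swap:
  fixes H :: "'a::euclidean_space \<times> 'a \<Rightarrow> ennreal"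
  assumes H: "H \<in> borel_measurable (borel \<Otimes>\<^sub>M borel)"
  shows "(\<integral>\<^sup>+z. H (snd z, fst z) \<partial>(lborel \<Otimes>\<^sub>M lborel)) = (\<integral>\<^sup>+z. H z \<partial>(lborel \<Otimes>\<^sub>M lborel))"
proof -
  have "(\<integral>\<^sup>+z. H z \<partial>(lborel \<Otimes>\<^sub>M lborel)) = (\<integral>\<^sup>+z. H z \<partial>distr (lborel \<Otimes>\<^sub>M lborel) (lborel \<Otimes>\<^sub>M lborel) (\<lambda>(x, y). (y, x)))"
    by (simp flip: lborel_pair.distr_pair_swap)
  also have "\<dots> = (\<integral>\<^sup>+z. H (case z of (x, y) \<Rightarrow> (y, x)) \<partial>(lborel \<Otimes>\<^sub>M lborel))"
    by (rule nn_integral_distr) (use H in measurable)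
  finally show ?thesis by (simp add: case_prod_beta')
qed

text \<open>Translates the hypothesis on the reflected domain into the finite energy of \<open>star k u\<close> on the
domain itself.\<close>

lemma gagliardo_star:
  fixes k :: "'n::finite" and v :: "real^'n \<Rightarrow> real"
  assumes v [measurable]: "v \<in> borel_measurable borel" and U [measurable]: "U \<in> sets borel" "reflect k ` U \<in> sets borel"
  shows "gagliardo s p U (star k v) = gagliardo s p (reflect k ` U) v"
proof -
  let ?T = "\<lambda>z. (reflect k (fst z), reflect k (snd z))"
  let ?H = "\<lambda>z. ennreal (\<bar>v (fst z) - v (snd z)\<bar> powr p / kernel_denom s p (fst z) (snd z)) * indicator (reflect k ` U) (fst z)"
  have [measurable]: "star k v \<in> borel_measurable borel"
    unfolding star_def by measurable
  have H: "?H \<in> borel_measurable (borel \<Otimes>\<^sub>M borel)" by measurable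
  have mem: "reflect k x \<in> reflect k ` U \<longleftrightarrow> x \<in> U" for x by (metis image_iff reflect_reflect)
  have "gagliardo s p U (star k v) = (\<integral>\<^sup>+z. ennreal (\<bar>star k v (fst z) - star k v (snd z)\<bar> powr p / kernel_denom s p (fst z) (snd z))
      * indicator U (fst z) \<partial>(lborel \<Otimes>\<^sub>M lborel))"
    by (rule gagliardo_lborel) measurable
  also have "\<dots> = (\<integral>\<^sup>+z. ?H (?T z) \<partial>(lborel \<Otimes>\<^sub>M lborel))"
    unfolding star_def kernel_denom_def fst_conv snd_conv norm_reflect_diff indicator_def mem ..
  also have "\<dots> = (\<integral>\<^sup>+z. ?H z \<partial>distr (lborel \<Otimes>\<^sub>M lborel) (borel \<Otimes>\<^sub>M borel) ?T)"
    by (rule nn_integral_distr[OF prod_map_measurable(2)[OF reflect_borel reflect_borel], symmetric]) (simp add: H)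
  also have "\<dots> = gagliardo s p (reflect k ` U) v"
    by (simp add: distr_prod_map distr_reflect gagliardo_lborel)
  finally show ?thesis .
qed

text \<open>The difference of the test values is zero unless one of the two points lies in \<open>U\<close>, where the energy
of \<open>v\<close> is finite.\<close>

lemma pairing_integrable:
  fixes v \<phi> :: "real^'n::finite \<Rightarrow> real"
  assumes p: "1 < p"
    and v [measurable]: "v \<in> borel_measurable borel" and \<phi> [measurable]: "\<phi> \<in> borel_measurable borel"
    and U [measurable]: "U \<in> sets borel" and zero: "\<And>x. x \<notin> U \<Longrightarrow> \<phi> x = 0"
    and gv: "gagliardo s p U v < \<infinity>" and g\<phi>: "gagliardo s p UNIV \<phi> < \<infinity>"
  shows "integrable (lborel \<Otimes>\<^sub>M lborel)
     (\<lambda>z. J p v (fst z) (snd z) * (\<phi> (fst z) - \<phi> (snd z)) / kernel_denom s p (fst z) (snd z))"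
proof (rule integrableI_bounded)
  let ?K = "\<lambda>z. kernel_denom s p (fst z) (snd z)"
  let ?v = "\<lambda>z. ennreal (\<bar>v (fst z) - v (snd z)\<bar> powr p / ?K z)"
  let ?f = "\<lambda>z. ennreal (\<bar>\<phi> (fst z) - \<phi> (snd z)\<bar> powr p / ?K z)"
  let ?H = "\<lambda>z. ?v z * indicator U (fst z)"
  let ?G = "\<lambda>z. J p v (fst z) (snd z) * (\<phi> (fst z) - \<phi> (snd z)) / ?K z"
  show "?G \<in> borel_measurable (lborel \<Otimes>\<^sub>M lborel)"
    unfolding J_eq_spow by measurable
  have le: "ennreal (norm (?G z)) \<le> ?H z + ?H (snd z, fst z) + ?f z" for z
  proof (cases "fst z \<in> U \<or> snd z \<in> U")
    case True
    have "norm (?G z) = \<bar>spow p (v (fst z) - v (snd z)) * (\<phi> (fst z) - \<phi> (snd z))\<bar> / ?K z"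
      by (simp add: J_eq_spow abs_mult kernel_denom_nonneg)
    also have "\<dots> \<le> (\<bar>v (fst z) - v (snd z)\<bar> powr p + \<bar>\<phi> (fst z) - \<phi> (snd z)\<bar> powr p) / ?K z"
      using p by (intro divide_right_mono spow_mult_le kernel_denom_nonneg)
    finally have "ennreal (norm (?G z)) \<le> ?v z + ?f z"
      by (simp add: add_divide_distrib kernel_denom_nonneg flip: ennreal_plus)
    moreover have "?v z \<le> ?H z + ?H (snd z, fst z)"
      using True by (auto simp: indicator_def abs_minus_commute kernel_denom_sym[of s p "snd z"])
    ultimately show ?thesis by (meson add_right_mono order_trans)
  next
    case False
    then show ?thesis by (simp add: zero)
  qed
  have "(\<integral>\<^sup>+z. ennreal (norm (?G z)) \<partial>(lborel \<Otimes>\<^sub>M lborel))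
      \<le> (\<integral>\<^sup>+z. ?H z + ?H (snd z, fst z) + ?f z \<partial>(lborel \<Otimes>\<^sub>M lborel))"
    by (intro nn_integral_mono le)
  also have "\<dots> = (\<integral>\<^sup>+z. ?H z + ?H (snd z, fst z) \<partial>(lborel \<Otimes>\<^sub>M lborel))
      + (\<integral>\<^sup>+z. ?f z \<partial>(lborel \<Otimes>\<^sub>M lborel))"
    by (rule nn_integral_add) measurable
  also have "(\<integral>\<^sup>+z. ?H z + ?H (snd z, fst z) \<partial>(lborel \<Otimes>\<^sub>M lborel))
      = (\<integral>\<^sup>+z. ?H z \<partial>(lborel \<Otimes>\<^sub>M lborel)) + (\<integral>\<^sup>+z. ?H (snd z, fst z) \<partial>(lborel \<Otimes>\<^sub>M lborel))"
    by (rule nn_integral_add) measurable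
  also have "(\<integral>\<^sup>+z. ?H (snd z, fst z) \<partial>(lborel \<Otimes>\<^sub>M lborel)) = (\<integral>\<^sup>+z. ?H z \<partial>(lborel \<Otimes>\<^sub>M lborel))"
    by (rule nn_integral_swap) measurable
  also have "(\<integral>\<^sup>+z. ?H z \<partial>(lborel \<Otimes>\<^sub>M lborel)) = gagliardo s p U v"
    by (rule gagliardo_lborel[symmetric]) measurable
  also have "(\<integral>\<^sup>+z. ?f z \<partial>(lborel \<Otimes>\<^sub>M lborel)) = gagliardo s p UNIV \<phi>"
    by (subst gagliardo_lborel) auto
  finally have "(\<integral>\<^sup>+z. ennreal (norm (?G z)) \<partial>(lborel \<Otimes>\<^sub>M lborel))
     \<le> gagliardo s p U v + gagliardo s p U v + gagliardo s p UNIV \<phi>" .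
  also have "gagliardo s p U v + gagliardo s p U v + gagliardo s p UNIV \<phi> < \<infinity>"
    using gv g\<phi> by (simp add: less_top[symmetric])
  finally show "(\<integral>\<^sup>+z. ennreal (norm (?G z)) \<partial>(lborel \<Otimes>\<^sub>M lborel)) < \<infinity>" .
qed

lemma powr_sum3_le:
  fixes t a b c p :: real
  assumes "0 \<le> p" "0 \<le> t" "t \<le> a + b + c" "0 \<le> a" "0 \<le> b" "0 \<le> c"
  shows "t powr p \<le> 3 powr p * (a powr p + b powr p + c powr p)"
proof -
  define M where "M = max a (max b c)"
  have "t powr p \<le> (3 * M) powr p" using assms by (intro powr_mono2) (auto simp: M_def)
  also have "\<dots> = 3 powr p * M powr p" using assms by (simp add: powr_mult M_def)
  also have "M powr p \<le> a powr p + b powr p + c powr p"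
    unfolding M_def by (auto simp: max_def)
  finally show ?thesis by (simp add: mult_left_mono)
qed

context reflected_order
begin

lemma borel_facts [measurable]:
  "u \<in> borel_measurable borel" "star k u \<in> borel_measurable borel" "gap \<in> borel_measurable borel"
  "bump \<in> borel_measurable borel" "bump_test \<epsilon> \<in> borel_measurable borel" "envelope \<in> borel_measurable borel"
  unfolding star_def envelope_def
  by (auto intro!: borel_measurable_continuous_onI cont cont_gap cont_bump cont_bump_test cont_u continuous_on_reflect)

lemma envelope_nonneg: "0 \<le> envelope t"
  by (simp add: envelope_def trunc_kernel_nonneg)

lemma envelope_finite: "(\<integral>\<^sup>+x. ennreal (envelope (norm (x :: real^'n))) \<partial>lborel) < \<infinity>"
  unfolding envelope_def using r sp by (intro trunc_kernel_finite) auto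

text \<open>The oscillation of the test function is at most that of \<open>\<epsilon> * bump\<close> plus those of \<open>u\<close> and \<open>star k u\<close>.
The latter two have finite energy over \<open>U\<close>. For the bump, the \<open>p\<close>-th power of an oscillation
not exceeding 1 is at most its power \<open>p - 1\<close>, so the integrable envelope of the pointwise estimate serves here
as well. Pairs of points outside the ball contribute nothing, and the remaining ones are obtained by
exchanging the variables.\<close>

lemma bump_test_Wsp0:
  assumes U: "open U" "ball x0 r \<subseteq> U" and \<epsilon>: "0 < \<epsilon>"
    and g1: "gagliardo s p U u < \<infinity>" and g2: "gagliardo s p U (star k u) < \<infinity>"
  shows "bump_test \<epsilon> \<in> Wsp0 s p U"
proof -
  let ?B = "ball x0 r"
  let ?K = "\<lambda>z. kernel_denom s p (fst z) (snd z)"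
  let ?u = "\<lambda>z. ennreal (\<bar>u (fst z) - u (snd z)\<bar> powr p / ?K z)"
  let ?us = "\<lambda>z. ennreal (\<bar>star k u (fst z) - star k u (snd z)\<bar> powr p / ?K z)"
  let ?t = "\<lambda>z. ennreal (\<bar>bump_test \<epsilon> (fst z) - bump_test \<epsilon> (snd z)\<bar> powr p / ?K z)"
  let ?envelope = "\<lambda>z. indicator ?B (fst z) * ennreal (envelope (norm (fst z - snd z)))"
  let ?H = "\<lambda>z. ennreal (3 powr p * \<epsilon> powr p) * ?envelope z + ennreal (3 powr p) * (?u z * indicator U (fst z))
      + ennreal (3 powr p) * (?us z * indicator U (fst z))"
  have [measurable]: "U \<in> sets borel" "?B \<in> sets borel" using U by simp_all
  have le1: "?t (x, y) \<le> ?H (x, y)" if x: "x \<in> ?B" for x y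
  proof -
    define D where "D = min 1 (norm (x - y) / r)"
    have D: "0 \<le> D" "D \<le> 1" using r by (auto simp: D_def)
    have "\<bar>bump_test \<epsilon> x - bump_test \<epsilon> y\<bar> \<le> \<bar>\<epsilon> * bump x - \<epsilon> * bump y\<bar> + \<bar>gap x - gap y\<bar>"
      unfolding bump_test_def by (auto simp: max_def)
    also have "\<bar>\<epsilon> * bump x - \<epsilon> * bump y\<bar> = \<epsilon> * \<bar>bump x - bump y\<bar>"
      using \<epsilon> by (simp add: abs_mult flip: right_diff_distrib)
    also have "\<dots> \<le> \<epsilon> * D"
      using \<epsilon> bump_diff[of x y] by (simp add: D_def)
    also have "\<bar>gap x - gap y\<bar> \<le> \<bar>u x - u y\<bar> + \<bar>star k u x - star k u y\<bar>"
      by (auto simp: gap_def star_def)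
    finally have "\<bar>bump_test \<epsilon> x - bump_test \<epsilon> y\<bar> \<le> \<epsilon> * D + \<bar>u x - u y\<bar> + \<bar>star k u x - star k u y\<bar>" by simp
    then have "\<bar>bump_test \<epsilon> x - bump_test \<epsilon> y\<bar> powr p \<le> 3 powr p * ((\<epsilon> * D) powr p + \<bar>u x - u y\<bar> powr p + \<bar>star k u x - star k u y\<bar> powr p)"
      using p \<epsilon> D by (intro powr_sum3_le) auto
    also have "(\<epsilon> * D) powr p = \<epsilon> powr p * D powr p" using \<epsilon> D by (simp add: powr_mult)
    also have "D powr p \<le> D powr (p - 1)" using p D by (cases "D = 0") (auto intro: powr_mono')
    finally have "\<bar>bump_test \<epsilon> x - bump_test \<epsilon> y\<bar> powr p \<le> 3 powr p * (\<epsilon> powr p * D powr (p - 1) + \<bar>u x - u y\<bar> powr p + \<bar>star k u x - star k u y\<bar> powr p)"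
      by (simp add: mult_left_mono)
    then have "\<bar>bump_test \<epsilon> x - bump_test \<epsilon> y\<bar> powr p / kernel_denom s p x y
       \<le> 3 powr p * (\<epsilon> powr p * D powr (p - 1) + \<bar>u x - u y\<bar> powr p + \<bar>star k u x - star k u y\<bar> powr p) / kernel_denom s p x y"
      by (rule divide_right_mono[OF _ kernel_denom_nonneg])
    also have "\<dots> = 3 powr p * \<epsilon> powr p * envelope (norm (x - y)) + 3 powr p * (\<bar>u x - u y\<bar> powr p / kernel_denom s p x y)
       + 3 powr p * (\<bar>star k u x - star k u y\<bar> powr p / kernel_denom s p x y)"
      by (simp add: envelope_def trunc_kernel_def D_def kernel_denom_def add_divide_distrib distrib_left)
    finally have "?t (x, y) \<le> ennreal (3 powr p * \<epsilon> powr p * envelope (norm (x - y)) + 3 powr p * (\<bar>u x - u y\<bar> powr p / kernel_denom s p x y)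
       + 3 powr p * (\<bar>star k u x - star k u y\<bar> powr p / kernel_denom s p x y))"
      by (simp add: ennreal_leI)
    also have "\<dots> = ?H (x, y)"
    proof -
      define \<alpha> where "\<alpha> = \<bar>u x - u y\<bar> powr p / kernel_denom s p x y"
      define \<beta> where "\<beta> = \<bar>star k u x - star k u y\<bar> powr p / kernel_denom s p x y"
      have "0 \<le> \<alpha>" "0 \<le> \<beta>" by (simp_all add: \<alpha>_def \<beta>_def kernel_denom_nonneg)
      then have "ennreal (3 powr p * \<epsilon> powr p * envelope (norm (x - y)) + 3 powr p * \<alpha> + 3 powr p * \<beta>)
          = ennreal (3 powr p * \<epsilon> powr p) * ennreal (envelope (norm (x - y))) + ennreal (3 powr p) * ennreal \<alpha> + ennreal (3 powr p) * ennreal \<beta>"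
        by (simp add: ennreal_mult'[symmetric] envelope_nonneg flip: ennreal_plus)
      then show ?thesis using x U(2) by (simp add: \<alpha>_def \<beta>_def subset_iff)
    qed
    finally show ?thesis .
  qed
  have le: "?t z \<le> ?H z + ?H (snd z, fst z)" for z
  proof -
    obtain x y where z: "z = (x, y)" by force
    consider "x \<in> ?B" | "y \<in> ?B" | "x \<notin> ?B" "y \<notin> ?B" by blast
    then show ?thesis
    proof cases
      case 1
      from le1[OF this, of y] show ?thesis unfolding z by (rule order_trans) simp
    next
      case 2
      have "?t (x, y) = ?t (y, x)" by (simp add: abs_minus_commute kernel_denom_sym[of s p x])
      with le1[OF 2, of x] have "?t (x, y) \<le> ?H (y, x)" by simp
      then show ?thesis unfolding z by (rule order_trans) simp
    next
      case 3
      then show ?thesis unfolding z by (simp add: bump_test_outside)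
    qed
  qed
  have Hfin: "(\<integral>\<^sup>+z. ?H z \<partial>(lborel \<Otimes>\<^sub>M lborel)) < \<infinity>"
  proof -
    have "(\<integral>\<^sup>+z. ?envelope z \<partial>(lborel \<Otimes>\<^sub>M lborel)) = (\<integral>\<^sup>+x. indicator ?B x \<partial>lborel) * (\<integral>\<^sup>+x. ennreal (envelope (norm (x :: real^'n))) \<partial>lborel)"
      by (rule nn_integral_convolution) measurable
    also have "\<dots> < \<infinity>"
      using envelope_finite emeasure_lborel_ball_finite[of x0 r] by (simp add: ennreal_mult_less_top)
    finally have "(\<integral>\<^sup>+z. ?envelope z \<partial>(lborel \<Otimes>\<^sub>M lborel)) < \<infinity>" .
    moreover have "(\<integral>\<^sup>+z. ?H z \<partial>(lborel \<Otimes>\<^sub>M lborel)) = ennreal (3 powr p * \<epsilon> powr p) * (\<integral>\<^sup>+z. ?envelope z \<partial>(lborel \<Otimes>\<^sub>M lborel))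
       + ennreal (3 powr p) * gagliardo s p U u + ennreal (3 powr p) * gagliardo s p U (star k u)"
    proof -
      have "(\<integral>\<^sup>+z. ?H z \<partial>(lborel \<Otimes>\<^sub>M lborel))
        = (\<integral>\<^sup>+z. ennreal (3 powr p * \<epsilon> powr p) * ?envelope z + ennreal (3 powr p) * (?u z * indicator U (fst z)) \<partial>(lborel \<Otimes>\<^sub>M lborel))
          + (\<integral>\<^sup>+z. ennreal (3 powr p) * (?us z * indicator U (fst z)) \<partial>(lborel \<Otimes>\<^sub>M lborel))"
        by (rule nn_integral_add) measurable
      also have "(\<integral>\<^sup>+z. ennreal (3 powr p * \<epsilon> powr p) * ?envelope z + ennreal (3 powr p) * (?u z * indicator U (fst z)) \<partial>(lborel \<Otimes>\<^sub>M lborel))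
        = (\<integral>\<^sup>+z. ennreal (3 powr p * \<epsilon> powr p) * ?envelope z \<partial>(lborel \<Otimes>\<^sub>M lborel))
          + (\<integral>\<^sup>+z. ennreal (3 powr p) * (?u z * indicator U (fst z)) \<partial>(lborel \<Otimes>\<^sub>M lborel))"
        by (rule nn_integral_add) measurable
      also have "(\<integral>\<^sup>+z. ennreal (3 powr p * \<epsilon> powr p) * ?envelope z \<partial>(lborel \<Otimes>\<^sub>M lborel))
         = ennreal (3 powr p * \<epsilon> powr p) * (\<integral>\<^sup>+z. ?envelope z \<partial>(lborel \<Otimes>\<^sub>M lborel))"
        by (rule nn_integral_cmult) measurable
      also have "(\<integral>\<^sup>+z. ennreal (3 powr p) * (?u z * indicator U (fst z)) \<partial>(lborel \<Otimes>\<^sub>M lborel))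
         = ennreal (3 powr p) * gagliardo s p U u"
        by (subst gagliardo_lborel, measurable) (rule nn_integral_cmult, measurable)
      also have "(\<integral>\<^sup>+z. ennreal (3 powr p) * (?us z * indicator U (fst z)) \<partial>(lborel \<Otimes>\<^sub>M lborel))
         = ennreal (3 powr p) * gagliardo s p U (star k u)"
        by (subst gagliardo_lborel, measurable) (rule nn_integral_cmult, measurable)
      finally show ?thesis .
    qed
    ultimately show ?thesis using g1 g2 by (simp add: ennreal_mult_eq_top_iff less_top[symmetric])
  qed
  have "gagliardo s p UNIV (bump_test \<epsilon>) = (\<integral>\<^sup>+z. ?t z \<partial>(lborel \<Otimes>\<^sub>M lborel))"
    by (subst gagliardo_lborel) auto
  also have "\<dots> \<le> (\<integral>\<^sup>+z. ?H z + ?H (snd z, fst z) \<partial>(lborel \<Otimes>\<^sub>M lborel))"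
    by (intro nn_integral_mono le)
  also have "\<dots> = (\<integral>\<^sup>+z. ?H z \<partial>(lborel \<Otimes>\<^sub>M lborel)) + (\<integral>\<^sup>+z. ?H (snd z, fst z) \<partial>(lborel \<Otimes>\<^sub>M lborel))"
    by (rule nn_integral_add) measurable
  also have "(\<integral>\<^sup>+z. ?H (snd z, fst z) \<partial>(lborel \<Otimes>\<^sub>M lborel)) = (\<integral>\<^sup>+z. ?H z \<partial>(lborel \<Otimes>\<^sub>M lborel))"
    by (rule nn_integral_swap) measurable
  finally have g: "gagliardo s p UNIV (bump_test \<epsilon>) < \<infinity>" using Hfin by (simp add: le_less_trans)
  have "(\<integral>\<^sup>+x. ennreal (\<bar>bump_test \<epsilon> x\<bar> powr p) \<partial>lebesgue) \<le> (\<integral>\<^sup>+x. ennreal (\<epsilon> powr p) * indicator ?B x \<partial>lebesgue)"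
  proof (rule nn_integral_mono)
    fix x
    show "ennreal (\<bar>bump_test \<epsilon> x\<bar> powr p) \<le> ennreal (\<epsilon> powr p) * indicator ?B x"
      using bump_test_le[OF \<epsilon>, of x] bump_test_nonneg[of \<epsilon> x] p bump_test_outside[of x \<epsilon>]
      by (cases "x \<in> ?B") (auto intro!: ennreal_leI powr_mono2)
  qed
  also have "\<dots> = ennreal (\<epsilon> powr p) * emeasure lebesgue ?B"
    by (rule nn_integral_cmult_indicator) simp
  also have "\<dots> < \<infinity>"
    using emeasure_lborel_ball_finite[of x0 r] by (simp add: ennreal_mult_less_top)
  finally have L: "bump_test \<epsilon> \<in> Lp p"
    by (simp add: Lp_def measurable_completion)
  have "bump_test \<epsilon> x = 0" if "x \<notin> U" for x
    using that U(2) by (intro bump_test_outside) auto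
  then show ?thesis using L g by (simp add: Wsp0_def Wsp_def)
qed

end

section \<open>Energy estimates and the strong comparison principle\<close>

lemma nn_integral_prod_mult:
  fixes g h :: "'a::euclidean_space \<Rightarrow> ennreal"
  assumes [measurable]: "g \<in> borel_measurable borel" "h \<in> borel_measurable borel"
  shows "(\<integral>\<^sup>+z. h (fst z) * g (snd z) \<partial>(lborel \<Otimes>\<^sub>M lborel)) = (\<integral>\<^sup>+x. h x \<partial>lborel) * (\<integral>\<^sup>+y. g y \<partial>lborel)"
proof -
  have "(\<integral>\<^sup>+z. h (fst z) * g (snd z) \<partial>(lborel \<Otimes>\<^sub>M lborel)) = (\<integral>\<^sup>+x. \<integral>\<^sup>+y. h x * g y \<partial>lborel \<partial>lborel)"
    by (subst lborel.nn_integral_fst[symmetric]) auto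
  also have "\<dots> = (\<integral>\<^sup>+x. h x * (\<integral>\<^sup>+y. g y \<partial>lborel) \<partial>lborel)"
    by (intro nn_integral_cong) (simp add: nn_integral_cmult)
  also have "\<dots> = (\<integral>\<^sup>+x. h x \<partial>lborel) * (\<integral>\<^sup>+y. g y \<partial>lborel)"
    by (rule nn_integral_multc) auto
  finally show ?thesis .
qed

context reflected_order
begin

lemma bump_test_integrable:
  assumes "0 < \<epsilon>" shows "integrable lborel (bump_test \<epsilon>)"
proof (rule Bochner_Integration.integrable_bound)
  show "integrable lborel (\<lambda>x. \<epsilon> * indicator (ball x0 r) x)"
    using emeasure_lborel_ball_finite[of x0 r] by simp
  show "AE x in lborel. norm (bump_test \<epsilon> x) \<le> norm (\<epsilon> * indicator (ball x0 r) x)"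
  proof (rule AE_I2)
    fix x
    show "norm (bump_test \<epsilon> x) \<le> norm (\<epsilon> * indicator (ball x0 r) x)"
      using assms bump_test_le[OF assms, of x] bump_test_nonneg[of \<epsilon> x] bump_test_outside[of x \<epsilon>]
      by (cases "x \<in> ball x0 r") auto
  qed
qed measurable

lemma bump_test_integral_pos:
  assumes "0 < \<epsilon>" "gap x0 = 0" shows "0 < (LINT x|lborel. bump_test \<epsilon> x)"
proof -
  have "(LINT x|lborel. bump_test \<epsilon> x) \<noteq> 0"
  proof
    assume "(LINT x|lborel. bump_test \<epsilon> x) = 0"
    then have "AE x in lborel. bump_test \<epsilon> x = 0"
      using integral_nonneg_eq_0_iff_AE[OF bump_test_integrable[OF assms(1)]] bump_test_nonneg by simp
    then have "{x. bump_test \<epsilon> x \<noteq> 0} \<in> null_sets lborel"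
      by (subst AE_iff_null_sets) auto
    then have "negligible {x. bump_test \<epsilon> x \<noteq> 0}"
      unfolding negligible_iff_null_sets by (rule null_sets_completionI)
    moreover have "open {x. bump_test \<epsilon> x \<noteq> 0}"
      by (intro open_Collect_neq cont_bump_test continuous_on_const)
    moreover have "x0 \<in> {x. bump_test \<epsilon> x \<noteq> 0}"
      using assms by (simp add: bump_test_def bump_def)
    ultimately show False using open_not_negligible by blast
  qed
  moreover have "0 \<le> (LINT x|lborel. bump_test \<epsilon> x)"
    by (intro integral_nonneg_AE AE_I2 bump_test_nonneg)
  ultimately show ?thesis by simp
qed

definition mass :: real where "mass = (LINT x|lborel. envelope (norm (x :: real^'n)))"

lemma majorant_integral:
  assumes \<epsilon>: "0 < \<epsilon>" and K [measurable]: "K \<in> sets borel" and fin: "emeasure lborel K < \<infinity>"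
  shows "has_bochner_integral (lborel \<Otimes>\<^sub>M lborel) (\<lambda>z. majorant \<epsilon> c K (fst z) (snd z))
    ((LINT x|lborel. bump_test \<epsilon> x) * (4 * \<epsilon> powr (p - 1) * mass - c * measure lborel K))"
proof -
  let ?I = "LINT x|lborel. bump_test \<epsilon> x"
  have I: "(\<integral>\<^sup>+x. ennreal (bump_test \<epsilon> x) \<partial>lborel) = ennreal ?I"
    by (rule nn_integral_eq_integral[OF bump_test_integrable[OF \<epsilon>]]) (simp add: bump_test_nonneg)
  have I0: "0 \<le> ?I" by (intro integral_nonneg_AE AE_I2 bump_test_nonneg)
  have mi: "integrable lborel (\<lambda>x::real^'n. envelope (norm x))"
    by (rule integrableI_bounded) (use envelope_finite in \<open>simp_all add: envelope_nonneg\<close>)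
  have M: "(\<integral>\<^sup>+x. ennreal (envelope (norm (x::real^'n))) \<partial>lborel) = ennreal mass"
    unfolding mass_def by (rule nn_integral_eq_integral[OF mi]) (simp add: envelope_nonneg)
  have M0: "0 \<le> mass" unfolding mass_def by (intro integral_nonneg_AE AE_I2 envelope_nonneg)
  have 1: "has_bochner_integral (lborel \<Otimes>\<^sub>M lborel) (\<lambda>z. bump_test \<epsilon> (fst z) * envelope (norm (fst z - snd z))) (?I * mass)"
  proof (rule has_bochner_integral_nn_integral)
    have "(\<integral>\<^sup>+z. ennreal (bump_test \<epsilon> (fst z)) * ennreal (envelope (norm (fst z - snd z))) \<partial>(lborel \<Otimes>\<^sub>M lborel))
       = (\<integral>\<^sup>+x. ennreal (bump_test \<epsilon> x) \<partial>lborel) * (\<integral>\<^sup>+x. ennreal (envelope (norm (x::real^'n))) \<partial>lborel)"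
      by (rule nn_integral_convolution) measurable
    then show "(\<integral>\<^sup>+z. ennreal (bump_test \<epsilon> (fst z) * envelope (norm (fst z - snd z))) \<partial>(lborel \<Otimes>\<^sub>M lborel)) = ennreal (?I * mass)"
      using I0 M0 by (simp add: I M ennreal_mult bump_test_nonneg envelope_nonneg)
  qed (use I0 M0 in \<open>simp_all add: bump_test_nonneg envelope_nonneg\<close>)
  have 2: "has_bochner_integral (lborel \<Otimes>\<^sub>M lborel) (\<lambda>z. bump_test \<epsilon> (fst z) * indicator K (snd z)) (?I * measure lborel K)"
  proof (rule has_bochner_integral_nn_integral)
    have "(\<integral>\<^sup>+z. ennreal (bump_test \<epsilon> (fst z)) * indicator K (snd z) \<partial>(lborel \<Otimes>\<^sub>M lborel))
       = (\<integral>\<^sup>+x. ennreal (bump_test \<epsilon> x) \<partial>lborel) * (\<integral>\<^sup>+x. indicator K x \<partial>lborel)"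
      by (rule nn_integral_prod_mult) measurable
    moreover have "(\<integral>\<^sup>+x. indicator K x \<partial>lborel) = ennreal (measure lborel K)"
      using fin by (simp add: emeasure_eq_ennreal_measure)
    moreover have "ennreal (indicator K y) = indicator K y" for y by (simp add: indicator_def)
    ultimately show "(\<integral>\<^sup>+z. ennreal (bump_test \<epsilon> (fst z) * indicator K (snd z)) \<partial>(lborel \<Otimes>\<^sub>M lborel)) = ennreal (?I * measure lborel K)"
      using I0 by (simp add: I ennreal_mult bump_test_nonneg)
  qed (use I0 in \<open>simp_all add: bump_test_nonneg\<close>)
  have "has_bochner_integral (lborel \<Otimes>\<^sub>M lborel)
    (\<lambda>z. 4 * \<epsilon> powr (p - 1) * (bump_test \<epsilon> (fst z) * envelope (norm (fst z - snd z))) - c * (bump_test \<epsilon> (fst z) * indicator K (snd z)))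
    (4 * \<epsilon> powr (p - 1) * (?I * mass) - c * (?I * measure lborel K))"
    by (intro has_bochner_integral_diff has_bochner_integral_mult_right 1 2)
  then show ?thesis by (simp add: majorant_def algebra_simps)
qed

lemma energy_upper:
  assumes \<epsilon>: "0 < \<epsilon>" "2 * \<epsilon> \<le> \<delta>"
    and int: "integrable (lborel \<Otimes>\<^sub>M lborel) (\<lambda>z. energy_density \<epsilon> (fst z) (snd z))"
    and Kc: "compact K"
    and K: "K \<subseteq> halfspace k" "K \<inter> ball x0 r = {}" "\<And>y. y \<in> K \<Longrightarrow> \<delta> \<le> gap y"
    and c: "\<And>x y. x \<in> ball x0 r \<Longrightarrow> y \<in> K \<Longrightarrow>
      c \<le> (spow p (u x - u y + \<delta> / 2) - spow p (u x - u y)) * (1 / kernel_denom s p x y - 1 / kernel_denom s p x (reflect k y))"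
  shows "(LINT z|(lborel \<Otimes>\<^sub>M lborel). energy_density \<epsilon> (fst z) (snd z))
    \<le> 2 * (LINT x|lborel. bump_test \<epsilon> x) * (4 * \<epsilon> powr (p - 1) * mass - c * measure lborel K)"
proof -
  have "K \<in> sets borel" "emeasure lborel K < \<infinity>"
    using Kc emeasure_bounded_finite[of K] by (auto simp: borel_compact compact_imp_bounded)
  note Q = majorant_integral[OF \<epsilon>(1) this, of c]
  have "(LINT z|(lborel \<Otimes>\<^sub>M lborel). energy_density \<epsilon> (fst z) (snd z)) \<le> 2 * (LINT z|(lborel \<Otimes>\<^sub>M lborel). majorant \<epsilon> c K (fst z) (snd z))"
    by (intro integral_le_by_reflection[where k = k] int integrable.intros[OF Q] pointwise[OF _ _ \<epsilon> K c])
  then show ?thesis using Q by (simp add: has_bochner_integral_integral_eq)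
qed

text \<open>Where the test function is positive, the gap is at most \<open>\<epsilon>\<close>.\<close>

lemma potential_lower:
  assumes \<epsilon>: "0 < \<epsilon>" and U: "ball x0 r \<subseteq> U" "U \<in> sets borel"
    and int: "set_integrable lebesgue U (\<lambda>x. V x * (u x - star k u x) * bump_test \<epsilon> x)"
    and V: "AE x in lebesgue. x \<in> ball x0 r \<longrightarrow> \<bar>V x\<bar> \<le> C"
  shows "- (C * \<epsilon>) * (LINT x|lborel. bump_test \<epsilon> x) \<le> (LINT x:U|lebesgue. V x * (u x - star k u x) * bump_test \<epsilon> x)"
proof -
  have ti: "integrable lebesgue (bump_test \<epsilon>)"
    using bump_test_integrable[OF \<epsilon>] by (simp add: integrable_completion)
  have "- (C * \<epsilon>) * (LINT x|lborel. bump_test \<epsilon> x) = (LINT x|lebesgue. - (C * \<epsilon>) * bump_test \<epsilon> x)"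
    by (simp add: integral_completion)
  also have "\<dots> \<le> (LINT x|lebesgue. indicator U x *\<^sub>R (V x * (u x - star k u x) * bump_test \<epsilon> x))"
  proof (rule integral_mono_AE)
    show "integrable lebesgue (\<lambda>x. - (C * \<epsilon>) * bump_test \<epsilon> x)" using ti by simp
    show "integrable lebesgue (\<lambda>x. indicator U x *\<^sub>R (V x * (u x - star k u x) * bump_test \<epsilon> x))"
      using int by (simp add: set_integrable_def)
    show "AE x in lebesgue. - (C * \<epsilon>) * bump_test \<epsilon> x \<le> indicator U x *\<^sub>R (V x * (u x - star k u x) * bump_test \<epsilon> x)"
      using V
    proof eventually_elim
      fix x assume Vx: "x \<in> ball x0 r \<longrightarrow> \<bar>V x\<bar> \<le> C"
      show "- (C * \<epsilon>) * bump_test \<epsilon> x \<le> indicator U x *\<^sub>R (V x * (u x - star k u x) * bump_test \<epsilon> x)"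
      proof (cases "bump_test \<epsilon> x = 0")
        case False
        then have x: "x \<in> ball x0 r" using bump_test_outside by blast
        have "\<bar>gap x\<bar> \<le> \<epsilon> * bump x" using False by (auto simp: bump_test_def max_def split: if_splits)
        also have "\<dots> \<le> \<epsilon>" using bump_range[of x] \<epsilon> by (simp add: mult_left_le)
        finally have "\<bar>V x\<bar> * \<bar>gap x\<bar> \<le> C * \<epsilon>" using Vx x by (intro mult_mono) auto
        then have "- (C * \<epsilon>) \<le> V x * gap x" by (simp flip: abs_mult)
        then have "- (C * \<epsilon>) * bump_test \<epsilon> x \<le> V x * gap x * bump_test \<epsilon> x"
          by (intro mult_right_mono bump_test_nonneg)
        then show ?thesis using x U by (simp add: gap_def star_def subset_iff)
      qed simp
    qed
  qed
  finally show ?thesis by (simp add: set_lebesgue_integral_def)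
qed

lemma energy_eq:
  assumes U: "open U" "ball x0 r \<subseteq> U" and \<epsilon>: "0 < \<epsilon>"
    and g1: "gagliardo s p U u < \<infinity>" and g2: "gagliardo s p U (star k u) < \<infinity>"
  shows "integrable (lborel \<Otimes>\<^sub>M lborel) (\<lambda>z. energy_density \<epsilon> (fst z) (snd z))"
    and "frac_p_laplacian s p u (bump_test \<epsilon>) - frac_p_laplacian s p (star k u) (bump_test \<epsilon>)
     = (LINT z|(lborel \<Otimes>\<^sub>M lborel). energy_density \<epsilon> (fst z) (snd z))"
proof -
  have gt: "gagliardo s p UNIV (bump_test \<epsilon>) < \<infinity>"
    using bump_test_Wsp0[OF assms] by (simp add: Wsp0_def Wsp_def)
  have Ub: "U \<in> sets borel" using U by simp
  have t0: "x \<notin> U \<Longrightarrow> bump_test \<epsilon> x = 0" for x using U bump_test_outside by blast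
  let ?G = "\<lambda>v z. J p v (fst z) (snd z) * (bump_test \<epsilon> (fst z) - bump_test \<epsilon> (snd z)) / kernel_denom s p (fst z) (snd z)"
  have G: "integrable (lborel \<Otimes>\<^sub>M lborel) (?G u)" "integrable (lborel \<Otimes>\<^sub>M lborel) (?G (star k u))"
    by (intro pairing_integrable[OF p(1) borel_facts(1,5) Ub t0 g1 gt]
       pairing_integrable[OF p(1) borel_facts(2,5) Ub t0 g2 gt]; assumption)+
  have energy_density_split: "energy_density \<epsilon> (fst z) (snd z) = ?G u z - ?G (star k u) z" for z
    by (simp add: energy_density_def left_diff_distrib diff_divide_distrib)
  show "integrable (lborel \<Otimes>\<^sub>M lborel) (\<lambda>z. energy_density \<epsilon> (fst z) (snd z))"
    unfolding energy_density_split using G by (rule Bochner_Integration.integrable_diff)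
  have fr: "frac_p_laplacian s p v (bump_test \<epsilon>) = (LINT z|(lborel \<Otimes>\<^sub>M lborel). ?G v z)"
    if "integrable (lborel \<Otimes>\<^sub>M lborel) (?G v)" for v
  proof -
    have "?G v \<in> borel_measurable (borel \<Otimes>\<^sub>M borel)"
      using borel_measurable_integrable[OF that] by simp
    then show ?thesis unfolding frac_p_laplacian_def by (rule integral_prod_completion)
  qed
  show "frac_p_laplacian s p u (bump_test \<epsilon>) - frac_p_laplacian s p (star k u) (bump_test \<epsilon>)
     = (LINT z|(lborel \<Otimes>\<^sub>M lborel). energy_density \<epsilon> (fst z) (snd z))"
    unfolding energy_density_split fr[OF G(1)] fr[OF G(2)] using G by (rule Bochner_Integration.integral_diff[symmetric])
qed

end

theorem theorem1p3:
  fixes k :: "'n::finite" and s p :: real and U :: "(real^'n) set"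
    and V u :: "real^'n \<Rightarrow> real"
  assumes "0 < s" "s < 1 / 2"
    and "1 / (1 - s) < p" "p < 2"
    and "open U" "U \<subseteq> halfspace k"
    and "V \<in> Linf_loc U"
    and "u \<in> Wsp_tilde s p U \<inter> Wsp_tilde s p (reflect k ` U) \<inter> Linf"
    and "continuous_on UNIV u"
    and "weak_solution k s p U V u"
    and "\<forall>x \<in> halfspace k. u x \<ge> star k u x"
  shows "(\<forall>x. u x = star k u x) \<or> (\<forall>x \<in> U. u x - star k u x > 0)"
proof (rule ccontr)
  assume "\<not> ?thesis"
  then obtain x0 y' where x0: "x0 \<in> U" "u x0 \<le> star k u x0" and y': "u y' \<noteq> star k u y'"
    by (auto simp: not_less)
  have x0k: "0 < x0 $ k" using x0 assms(6) by (auto simp: halfspace_def)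
  have wx0: "u x0 - u (reflect k x0) = 0"
    using x0 assms(6,11) by (force simp: star_def)
  have fixed: "reflect k x = x" if "x $ k = 0" for x
    using that by (auto simp: vec_eq_iff reflect_nth)
  obtain y0 where y0: "0 < y0 $ k" "u y0 \<noteq> u (reflect k y0)"
  proof -
    consider "0 < y' $ k" | "y' $ k = 0" | "0 < reflect k y' $ k"
      by (auto simp: reflect_nth) (meson linorder_neqE_linordered_idom)
    then show thesis
      using that[of y'] that[of "reflect k y'"] y' fixed[of y'] by cases (auto simp: star_def)
  qed
  have order: "u (reflect k x) \<le> u x" if "0 \<le> x $ k" for x
    using that assms(11) fixed[of x] by (cases "x $ k = 0") (auto simp: halfspace_def star_def)
  define W where "W = (\<lambda>x. u x - u (reflect k x))"
  have contW: "continuous_on UNIV W"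
    unfolding W_def by (intro continuous_intros continuous_on_compose2[OF assms(9)]) auto
  define \<delta> where "\<delta> = W y0 / 2"
  have \<delta>: "0 < \<delta>" using order[of y0] y0 by (simp add: \<delta>_def W_def)
  have "x0 \<noteq> y0" using y0 wx0 by auto
  then have dist: "0 < dist x0 y0" by simp
  obtain \<rho> where \<rho>: "0 < \<rho>" "ball x0 \<rho> \<subseteq> U" using assms(5) x0(1) openE by blast
  obtain \<eta> where \<eta>: "0 < \<eta>" "\<And>y. dist y y0 < \<eta> \<Longrightarrow> dist (W y) (W y0) < \<delta>"
    using contW \<delta> unfolding continuous_on_iff by (metis UNIV_I)
  \<comment> \<open>Radii so small that the ball about \<open>x0\<close> stays in \<open>U\<close> and away from the hyperplane, that \<open>K\<close> stays in the
    half-space with gap at least \<open>\<delta>\<close>, and that the two balls are disjoint.\<close>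
  define r where "r = min (\<rho> / 2) (min (x0 $ k / 2) (dist x0 y0 / 4))"
  define \<kappa> where "\<kappa> = min (\<eta> / 2) (min (y0 $ k / 2) (dist x0 y0 / 4))"
  define K where "K = cball y0 \<kappa>"
  have r: "0 < r" "r < \<rho>" "2 * r \<le> x0 $ k" "r \<le> dist x0 y0 / 4"
    using \<rho> x0k dist by (auto simp: r_def min_less_iff_disj min_le_iff_disj)
  have \<kappa>: "0 < \<kappa>" "\<kappa> < \<eta>" "\<kappa> \<le> y0 $ k / 2" "\<kappa> \<le> dist x0 y0 / 4"
    using \<eta> y0 dist by (auto simp: \<kappa>_def min_less_iff_disj min_le_iff_disj)
  have sp: "0 < s * p" "s * p < p - 1" and p1: "1 < p"
  proof -
    have "1 < p * (1 - s)" using assms(1-3) by (simp add: field_simps)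
    then show "s * p < p - 1" by (simp add: algebra_simps)
    have "1 \<le> 1 / (1 - s)" using assms(1,2) by (simp add: field_simps)
    then show "1 < p" using assms(3) by simp
    then show "0 < s * p" using assms(1) by simp
  qed
  interpret R: reflected_order k s p r x0 u
    by unfold_locales (use p1 assms(4,9) sp order r in auto)
  have W_eq: "W = R.gap" by (simp add: W_def R.gap_def fun_eq_iff)
  have cb: "cball x0 r \<subseteq> U" using \<rho> r by (auto simp: subset_iff)
  then have b: "ball x0 r \<subseteq> U" by (auto simp: subset_iff)
  have K: "compact K" "K \<subseteq> halfspace k" "\<And>y. y \<in> K \<Longrightarrow> \<delta> \<le> R.gap y"
  proof -
    show "compact K" by (simp add: K_def)
    show "K \<subseteq> halfspace k"
    proof
      fix y assume "y \<in> K"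
      then have "\<bar>y0 $ k - y $ k\<bar> \<le> y0 $ k / 2"
        using component_le_norm_cart[of "y0 - y" k] \<kappa> by (auto simp: K_def dist_norm)
      then have "y0 $ k - y $ k \<le> y0 $ k / 2" by linarith
      then show "y \<in> halfspace k" using y0(1) by (simp add: halfspace_def)
    qed
    show "\<delta> \<le> R.gap y" if "y \<in> K" for y
    proof -
      have "dist y y0 < \<eta>" using that \<kappa> by (simp add: K_def dist_commute)
      then have "\<bar>W y - W y0\<bar> < \<delta>" using \<eta>(2) by (simp add: dist_real_def)
      then have "W y0 - \<delta> < W y" by linarith
      then show ?thesis by (simp add: \<delta>_def flip: W_eq)
    qed
  qed
  have disj: "K \<inter> cball x0 r = {}"
  proof -
    have False if "dist y0 y \<le> \<kappa>" "dist x0 y \<le> r" for y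
      using that r \<kappa> dist dist_triangle2[of x0 y0 y] by (simp add: dist_commute)
    then show ?thesis by (auto simp: K_def)
  qed
  have disjb: "K \<inter> ball x0 r = {}" using disj by auto
  \<comment> \<open>The gain from \<open>K\<close> is the minimum of a positive continuous function on a compact set; it is chosen
    before \<open>\<epsilon>\<close>.\<close>
  define g where "g = (\<lambda>z. (spow p (u (fst z) - u (snd z) + \<delta> / 2) - spow p (u (fst z) - u (snd z))) *
     (1 / kernel_denom s p (fst z) (snd z) - 1 / kernel_denom s p (fst z) (reflect k (snd z))))"
  have gpos: "0 < g z" if "z \<in> cball x0 r \<times> K" for z
  proof -
    have z: "0 < fst z $ k" "0 < snd z $ k" "fst z \<noteq> snd z"
      using that cb K(2) assms(6) disj by (auto simp: halfspace_def subset_iff)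
    have "spow p (u (fst z) - u (snd z)) < spow p (u (fst z) - u (snd z) + \<delta> / 2)"
      using p1 \<delta> by (intro spow_strict_mono) auto
    moreover have "1 / kernel_denom s p (fst z) (reflect k (snd z)) < 1 / kernel_denom s p (fst z) (snd z)"
      unfolding kernel_denom_def using norm_reflect_greater[OF z(1,2)] z(3) sp
      by (intro divide_strict_left_mono powr_less_mono2 mult_pos_pos) (auto intro: add_nonneg_pos)
    ultimately show ?thesis unfolding g_def by (intro mult_pos_pos) auto
  qed
  have gcont: "continuous_on (cball x0 r \<times> K) g"
  proof -
    have ne: "fst z \<noteq> snd z" "fst z \<noteq> reflect k (snd z)" if "z \<in> cball x0 r \<times> K" for z
    proof -
      show "fst z \<noteq> snd z" using that disj by auto
      have "0 < fst z $ k" "0 < snd z $ k"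
        using that cb K(2) assms(6) by (auto simp: halfspace_def subset_iff)
      then show "fst z \<noteq> reflect k (snd z)" by (auto simp: reflect_nth)
    qed
    show ?thesis
      unfolding g_def kernel_denom_def
      by (intro continuous_intros continuous_on_powr' R.cont_u p1) (use ne in auto)
  qed
  have ne: "cball x0 r \<times> K \<noteq> {}" using r \<kappa> by (auto simp: K_def)
  have "compact (cball x0 r \<times> K)" using K by (intro compact_Times) auto
  from continuous_attains_inf[OF this ne gcont]
  obtain z0 where z0: "z0 \<in> cball x0 r \<times> K" "\<And>z. z \<in> cball x0 r \<times> K \<Longrightarrow> g z0 \<le> g z" by blast
  define c where "c = g z0"
  have c: "0 < c" using gpos z0 by (simp add: c_def)
  have cg: "c \<le> (spow p (u x - u y + \<delta> / 2) - spow p (u x - u y)) * (1 / kernel_denom s p x y - 1 / kernel_denom s p x (reflect k y))"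
    if "x \<in> ball x0 r" "y \<in> K" for x y
    using z0(2)[of "(x, y)"] that by (auto simp: c_def g_def)
  have "\<exists>C. AE x in lebesgue. x \<in> cball x0 r \<longrightarrow> \<bar>V x\<bar> \<le> C"
    using assms(7) cb compact_cball[of x0 r] unfolding Linf_loc_def by blast
  then obtain C where C: "AE x in lebesgue. x \<in> cball x0 r \<longrightarrow> \<bar>V x\<bar> \<le> C" by blast
  then have C': "AE x in lebesgue. x \<in> ball x0 r \<longrightarrow> \<bar>V x\<bar> \<le> C"
    by eventually_elim auto
  have Kpos: "0 < measure lborel K" using \<kappa> by (simp add: K_def)
  \<comment> \<open>All error terms vanish as \<open>\<epsilon>\<close> tends to 0, because \<open>p > 1\<close>.\<close>
  have lim: "((\<lambda>\<epsilon>. C * \<epsilon> + 8 * R.mass * \<epsilon> powr (p - 1)) \<longlongrightarrow> C * 0 + 8 * R.mass * 0) (at_right 0)"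
    using p1 by (intro tendsto_intros tendsto_zero_powrI[where b = "p - 1"]) (auto simp: eventually_at_filter)
  have "\<forall>\<^sub>F \<epsilon> in at_right 0. C * \<epsilon> + 8 * R.mass * \<epsilon> powr (p - 1) < 2 * c * measure lborel K"
    using c Kpos by (intro order_tendstoD(2)[OF lim]) simp
  moreover have "\<forall>\<^sub>F \<epsilon> in at_right 0. \<epsilon> \<in> {0<..<\<delta> / 2}"
    using \<delta> by (intro eventually_at_right_real) simp
  ultimately have "\<forall>\<^sub>F \<epsilon> in at_right 0. C * \<epsilon> + 8 * R.mass * \<epsilon> powr (p - 1) < 2 * c * measure lborel K \<and> \<epsilon> \<in> {0<..<\<delta> / 2}"
    by (rule eventually_conj)
  then obtain \<epsilon> where \<epsilon>: "C * \<epsilon> + 8 * R.mass * \<epsilon> powr (p - 1) < 2 * c * measure lborel K" "0 < \<epsilon>" "2 * \<epsilon> \<le> \<delta>"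
    using eventually_happens'[OF trivial_limit_at_right_real] by fastforce
  have g1: "gagliardo s p U u < \<infinity>" using assms(8) by (simp add: Wsp_tilde_def)
  have g2: "gagliardo s p U (star k u) < \<infinity>"
  proof -
    have "reflect k ` U = reflect k -` U" by force
    moreover have "open (reflect k -` U)"
      by (rule open_vimage[OF assms(5) continuous_on_reflect[OF continuous_on_id]])
    ultimately have "open (reflect k ` U)" by simp
    then have "gagliardo s p U (star k u) = gagliardo s p (reflect k ` U) u"
      using assms(5) by (intro gagliardo_star borel_measurable_continuous_onI assms(9)) auto
    then show ?thesis using assms(8) by (simp add: Wsp_tilde_def)
  qed
  let ?I = "LINT x|lborel. R.bump_test \<epsilon> x"
  have I: "0 < ?I" using R.bump_test_integral_pos[OF \<epsilon>(2)] wx0 by (simp add: R.gap_def)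
  have bump_test: "R.bump_test \<epsilon> \<in> Wsp0 s p U" by (rule R.bump_test_Wsp0[OF assms(5) b \<epsilon>(2) g1 g2])
  have int: "set_integrable lebesgue U (\<lambda>x. V x * (u x - star k u x) * R.bump_test \<epsilon> x)"
    using assms(10) bump_test by (simp add: weak_solution_def in_Wsp0_dual_def)
  have "- (C * \<epsilon>) * ?I \<le> (LINT x:U|lebesgue. V x * (u x - star k u x) * R.bump_test \<epsilon> x)"
    using assms(5) by (intro R.potential_lower[OF \<epsilon>(2) b _ int C']) simp
  also have "\<dots> \<le> frac_p_laplacian s p u (R.bump_test \<epsilon>) - frac_p_laplacian s p (star k u) (R.bump_test \<epsilon>)"
    using assms(10) bump_test R.bump_test_nonneg by (simp add: weak_solution_def)
  also have "\<dots> = (LINT z|(lborel \<Otimes>\<^sub>M lborel). R.energy_density \<epsilon> (fst z) (snd z))"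
    by (rule R.energy_eq(2)[OF assms(5) b \<epsilon>(2) g1 g2])
  also have "\<dots> \<le> 2 * ?I * (4 * \<epsilon> powr (p - 1) * R.mass - c * measure lborel K)"
    by (rule R.energy_upper[OF \<epsilon>(2,3) R.energy_eq(1)[OF assms(5) b \<epsilon>(2) g1 g2] K(1,2) disjb K(3) cg])
  finally have "0 \<le> ?I * (C * \<epsilon> + 8 * R.mass * \<epsilon> powr (p - 1) - 2 * c * measure lborel K)"
    by (simp add: algebra_simps)
  then show False using I \<epsilon>(1) by (simp add: zero_le_mult_iff)
qed

end
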